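(* Let $D$ be a domain in $\mathbb{C}_\infty$, let $k$ be a positive integer, and let $\mathcal{F}\subseteq\mathcal{M}(D)$ be such that all zeros of each $f\in\mathcal{F}$ are of multiplicity at least $k+1$. Suppose that, for some $\epsilon>0$, for each $f\in\mathcal{F}$ there exist three functions $a_{1f},a_{2f},a_{3f}\in\mathcal{M}(D)\cup\{\infty\}$ satisfying $$\sigma(a_{jf}(z),a_{lf}(z))\geq\epsilon\quad\text{for } j\neq l \text{ and } z\in D .$$ If for each pair of functions $f$ and $g$ in $\mathcal{F}$, $f^{(k)}-a_{jf}$ and $g^{(k)}-a_{jg}$ share $0$ in $D$ $(j=1,2,3)$, then $\mathcal{F}$ is normal in $D$.
   Context: $\mathbb{C}_\infty=\mathbb{C}\cup\{\infty\}$ is the Riemann sphere and $\sigma$ is the spherical metric on it (great-circle distance on the unit sphere, so the diameter is $\pi$). $\mathcal{M}(D)$ is the class of all meromorphic functions on the domain $D$ in $\mathbb{C}_\infty$, regarded as maps into $\mathbb{C}_\infty$, and $\mathcal{M}(D)\cup\{\infty\}$ also includes the function identically equal to $\infty$. $f^{(k)}$ is the $k$-th derivative of $f$. A family $\mathcal{F}\subseteq\mathcal{M}(D)$ is normal on $D$ if every sequence in $\mathcal{F}$ has a subsequence converging locally uniformly on $D$ with respect to $\sigma$ to a limit function which is either meromorphic on $D$ or identically $\infty$. For $F\in\mathcal{M}(D)$ and $a\in\mathcal{M}(D)\cup\{\infty\}$, a zero of $F-a$ means a point $z\in D$ with $F(z)=a(z)$ in $\mathbb{C}_\infty$ (so points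 where both take the value $\infty$ are included). "$F-a$ and $G-b$ share $0$ in $D$" means that they have the same set of zeros in $D$, ignoring multiplicities: for $z\in D$, $F(z)=a(z)$ if and only if $G(z)=b(z)$.
   Formalization: If ∞ lies in D, the sharing of zeros is also assumed, in a neighbourhood of ∞, for the k-th derivatives taken in the coordinate 1/z; with z-derivatives alone the claim fails (f_n = z^k/n on |z|>1 with ∞). For D contained in the plane nothing changes. *)

theory Defs
  imports "HOL-Complex_Analysis.Complex_Analysis"
begin

text \<open>
  The Riemann sphere is the one-point compactification of the plane; \<^term>\<open>None\<close> is the point
  at infinity.
\<close>

type_synonym csphere = "complex option"

abbreviation sphere_top :: "csphere topology" where
  "sphere_top \<equiv> Alexandroff_compactification euclidean"

definition sphere_domain :: "csphere set \<Rightarrow> bool" where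
  "sphere_domain D \<longleftrightarrow> D \<noteq> {} \<and> openin sphere_top D \<and> connectedin sphere_top D"

text \<open>
  Inverse stereographic projection onto the unit sphere of \<open>complex \<times> real\<close>, which is Euclidean
  3-space; the great-circle distance of two unit vectors is the angle between them.
\<close>

definition stereo :: "csphere \<Rightarrow> complex \<times> real" where
  "stereo p = (case p of
     None \<Rightarrow> (0, 1)
   | Some z \<Rightarrow> ((2 / ((cmod z)\<^sup>2 + 1)) *\<^sub>R z, ((cmod z)\<^sup>2 - 1) / ((cmod z)\<^sup>2 + 1)))"

definition sph_dist :: "csphere \<Rightarrow> csphere \<Rightarrow> real" where
  "sph_dist p q = arccos (stereo p \<bullet> stereo q)"

text \<open>
  The sphere is covered by the two coordinate parametrizations \<^term>\<open>Some\<close> (coordinate \<open>z\<close>) and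
  \<open>recip\<close> (coordinate \<open>w = 1/z\<close>, with \<open>w = 0\<close> at infinity). Analytic notions for a function \<open>f\<close> on
  a subset \<open>D\<close> of the sphere are expressed through \<open>f \<circ> \<phi>\<close> on the planar set \<open>\<phi> -` D\<close>, where
  \<open>\<phi>\<close> is one of the two.
\<close>

definition recip :: "complex \<Rightarrow> csphere" where
  "recip w = (if w = 0 then None else Some (1 / w))"

abbreviation sphere_charts :: "(complex \<Rightarrow> csphere) set" where
  "sphere_charts \<equiv> {Some, recip}"

text \<open>
  Translation between sphere-valued maps \<open>h\<close> and the complex-valued functions of the library:
  \<open>finite_part h\<close> carries the dummy value 0 at the poles, as
  \<^const>\<open>nicely_meromorphic_on\<close> requires.
\<close>

definition finite_part :: "(complex \<Rightarrow> csphere) \<Rightarrow> complex \<Rightarrow> complex" where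
  "finite_part h z = (case h z of None \<Rightarrow> 0 | Some w \<Rightarrow> w)"

definition to_sphere :: "(complex \<Rightarrow> complex) \<Rightarrow> complex \<Rightarrow> csphere" where
  "to_sphere g z = (if is_pole g z then None else Some (g z))"

definition mero_map_on :: "(complex \<Rightarrow> csphere) \<Rightarrow> complex set \<Rightarrow> bool" where
  "mero_map_on h A \<longleftrightarrow>
     finite_part h nicely_meromorphic_on A \<and> (\<forall>z\<in>A. h z = to_sphere (finite_part h) z)"

definition mero :: "csphere set \<Rightarrow> (csphere \<Rightarrow> csphere) set" where
  "mero D = {f. \<forall>\<phi>\<in>sphere_charts. mero_map_on (f \<circ> \<phi>) (\<phi> -` D)}"

definition mero_inf :: "csphere set \<Rightarrow> (csphere \<Rightarrow> csphere) set" where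
  "mero_inf D = mero D \<union> {f. \<forall>p\<in>D. f p = None}"

text \<open>
  \<^const>\<open>zorder\<close> is unspecified for a function vanishing identically near the point; such a zero
  has infinite multiplicity.
\<close>

definition zero_mult_ge :: "nat \<Rightarrow> (complex \<Rightarrow> complex) \<Rightarrow> complex \<Rightarrow> bool" where
  "zero_mult_ge m g z \<longleftrightarrow> (\<forall>\<^sub>F w in at z. g w = 0) \<or> zorder g z \<ge> int m"

definition zeros_mult_ge :: "nat \<Rightarrow> (csphere \<Rightarrow> csphere) \<Rightarrow> csphere set \<Rightarrow> bool" where
  "zeros_mult_ge m f D \<longleftrightarrow>
     (\<forall>\<phi>\<in>sphere_charts. \<forall>z\<in>\<phi> -` D.
        f (\<phi> z) = Some 0 \<longrightarrow> zero_mult_ge m (finite_part (f \<circ> \<phi>)) z)"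

text \<open>
  The \<open>k\<close>-th derivative of a meromorphic map of the plane, again as a map into the sphere. Applied
  to \<open>f \<circ> Some\<close> it is the derivative with respect to \<open>z\<close>, applied to \<open>f \<circ> recip\<close> it is the
  derivative with respect to the coordinate \<open>1/z\<close> at infinity.
\<close>

definition mderiv :: "nat \<Rightarrow> (complex \<Rightarrow> csphere) \<Rightarrow> complex \<Rightarrow> csphere" where
  "mderiv k h = to_sphere ((deriv ^^ k) (finite_part h))"

definition normal_family :: "csphere set \<Rightarrow> (csphere \<Rightarrow> csphere) set \<Rightarrow> bool" where
  "normal_family D \<F> \<longleftrightarrow>
     (\<forall>s. range s \<subseteq> \<F> \<longrightarrow>
       (\<exists>r h. strict_mono (r :: nat \<Rightarrow> nat) \<and> h \<in> mero_inf D \<and>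
         (\<forall>p\<in>D. \<exists>U. openin sphere_top U \<and> p \<in> U \<and> U \<subseteq> D \<and>
           (\<forall>e>0. \<forall>\<^sub>F n in sequentially. \<forall>q\<in>U. sph_dist (s (r n) q) (h q) < e))))"

end

theory Submission
  imports Defs "HOL-Library.Diagonal_Subsequence"
begin

text \<open>
  Why the theorem holds. Fix a point \<open>z0\<close> of \<open>D\<close>, work in a chart there and write \<open>F = f\<^sup>(\<^sup>k\<^sup>)\<close>. Sharing
  says that the sets \<open>E j\<close> where \<open>F\<close> meets \<open>a j f\<close> are the same for all members of the family. By the
  identity theorem \<open>E j\<close> is near \<open>z0\<close> either a full disc or contained in \<open>{z0}\<close>, and as the three
  functions are separated, \<open>z0\<close> lies in at most one of the three sets. So there is one disc on which
  every \<open>F\<close> avoids two of its functions completely, and either avoids the third one outside \<open>z0\<close> or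
  coincides with it.

  The derivatives are then under uniform control. The cross ratio of \<open>F\<close> and its three functions is
  holomorphic without zeros, and it is either constantly 1 or different from 1 outside \<open>z0\<close>; Schottky's
  theorem on a circle around \<open>z0\<close> and the maximum principle bound it or its reciprocal
  (\<open>schottky_punctured\<close>). Two separated functions \<open>a\<close>, \<open>b\<close> are themselves under control, because
  \<open>1/(a - b)\<close>, \<open>a/(a - b)\<close>, \<open>b/(a - b)\<close> and \<open>a b/(a - b)\<close> are bounded holomorphic functions
  (\<open>separated_imp_chart_bounded\<close>). Together, on a smaller disc and with a constant \<open>M\<close> common to the
  family, \<open>|F| \<le> M\<close> throughout or \<open>|1/F| \<le> M\<close> throughout (\<open>omits_three_imp_chart_bounded\<close>).

  The multiplicities of the zeros carry this back to \<open>f\<close>. Let \<open>|F| \<le> M\<close>, so that \<open>f\<close> is holomorphic. If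
  \<open>f\<close> has a zero in the disc, its Taylor formula there reduces to the remainder, and \<open>f\<close> is bounded.
  Functions without zeros that are not bounded tend to infinity along a subsequence, by Hurwitz's
  theorem for the functions divided by their maxima (\<open>bounded_derivative_subsequence\<close>). Let now
  \<open>|1/F| \<le> M\<close>. A zero of \<open>f\<close> would be a zero of \<open>F\<close>, so \<open>v = 1/f\<close> is holomorphic. If \<open>v\<close> were huge at a
  point, chosen so that a suitably weighted modulus of \<open>v\<close> is maximal, then \<open>v\<close> would be nearly constant
  on a comparatively large disc around it, and the \<open>k\<close>-th derivative of \<open>1/v\<close> would be tiny there; so
  \<open>v\<close> is bounded (\<open>reciprocal_bound\<close>). In all cases Montel's theorem gives a subsequence that
  converges near \<open>z0\<close> (\<open>planar_normality\<close>).

  A diagonal argument over a countable base of the topology yields a subsequence that converges near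
  every point of \<open>D\<close>. Its limit is locally a ratio of holomorphic functions, and as \<open>D\<close> is connected it
  is meromorphic or constantly infinite (\<open>sph_hol_imp_mero_inf\<close>).
\<close>

section \<open>Spherical distance in homogeneous coordinates\<close>

text \<open>
  Homogeneous coordinates \<open>[p : q]\<close>. In them infinity is a point like any other, and both nearness and
  separation of two points become bounds on the determinant \<open>p q' - p' q\<close>.
\<close>

definition hpoint :: "complex \<Rightarrow> complex \<Rightarrow> csphere" where
  "hpoint p q = (if q = 0 then None else Some (p / q))"

lemma hpoint_one [simp]: "hpoint x 1 = Some x"
  by (simp add: hpoint_def)

lemma hpoint_recip: "recip y = hpoint 1 y"
  by (simp add: hpoint_def recip_def)

lemma hpoint_cases:
  obtains p q where "p \<noteq> 0 \<or> q \<noteq> 0" "h = hpoint p q"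
  by (cases h) (metis hpoint_def zero_neq_one, metis hpoint_one zero_neq_one)

lemma hpoint_scale: "c \<noteq> 0 \<Longrightarrow> hpoint (c * p) (c * q) = hpoint p q"
  by (simp add: hpoint_def)

lemma hpoint_eq_iff:
  assumes "p \<noteq> 0 \<or> q \<noteq> 0" "p' \<noteq> 0 \<or> q' \<noteq> 0"
  shows "hpoint p q = hpoint p' q' \<longleftrightarrow> p * q' - p' * q = 0"
  using assms by (auto simp: hpoint_def field_simps)

lemma stereo_hpoint:
  assumes "p \<noteq> 0 \<or> q \<noteq> 0"
  shows "stereo (hpoint p q) =
    ((2 / ((cmod p)\<^sup>2 + (cmod q)\<^sup>2)) *\<^sub>R (p * cnj q),
     ((cmod p)\<^sup>2 - (cmod q)\<^sup>2) / ((cmod p)\<^sup>2 + (cmod q)\<^sup>2))"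
proof (cases "q = 0")
  case True
  then show ?thesis using assms by (simp add: hpoint_def stereo_def zero_prod_def)
next
  case False
  have 1: "(cmod (p/q))\<^sup>2 = (cmod p)\<^sup>2 / (cmod q)\<^sup>2"
    by (simp add: norm_divide power_divide)
  have q: "(cmod q)\<^sup>2 > 0" using False by simp
  then have N: "(cmod p)\<^sup>2 + (cmod q)\<^sup>2 > 0" by (simp add: add_nonneg_pos)
  have frac: "(a / b - 1) / (a / b + 1) = (a - b) / (a + b)" if "b > 0" "a + b > 0" for a b :: real
    using that by (simp add: divide_simps)
  have 2: "2 / ((cmod p)\<^sup>2 / (cmod q)\<^sup>2 + 1) = 2 * (cmod q)\<^sup>2 / ((cmod p)\<^sup>2 + (cmod q)\<^sup>2)"
    using q N by (simp add: field_simps)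
  have 3: "p / q = p * cnj q / of_real ((cmod q)\<^sup>2)"
    using False by (simp only: complex_norm_square) simp
  have 4: "((cmod p)\<^sup>2 / (cmod q)\<^sup>2 - 1) / ((cmod p)\<^sup>2 / (cmod q)\<^sup>2 + 1)
      = ((cmod p)\<^sup>2 - (cmod q)\<^sup>2) / ((cmod p)\<^sup>2 + (cmod q)\<^sup>2)"
    using frac q N by blast
  have 5: "(2 * (cmod q)\<^sup>2 / ((cmod p)\<^sup>2 + (cmod q)\<^sup>2)) *\<^sub>R (p * cnj q / of_real ((cmod q)\<^sup>2))
     = (2 / ((cmod p)\<^sup>2 + (cmod q)\<^sup>2)) *\<^sub>R (p * cnj q)"
    using q N by (simp add: scaleR_conv_of_real field_simps)
  then show ?thesis
    using False 5[folded 3] by (simp add: hpoint_def stereo_def 1 2 4)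
qed

text \<open>
  Both sides are half the squared length of the chord between the two points.
\<close>

lemma chordal_formula:
  assumes "p \<noteq> 0 \<or> q \<noteq> 0" "p' \<noteq> 0 \<or> q' \<noteq> 0"
  shows "1 - stereo (hpoint p q) \<bullet> stereo (hpoint p' q') =
    2 * (cmod (p * q' - p' * q))\<^sup>2 / (((cmod p)\<^sup>2 + (cmod q)\<^sup>2) * ((cmod p')\<^sup>2 + (cmod q')\<^sup>2))"
proof -
  define N N' where "N = (cmod p)\<^sup>2 + (cmod q)\<^sup>2" and "N' = (cmod p')\<^sup>2 + (cmod q')\<^sup>2"
  have N: "N > 0" "N' > 0" unfolding N_def N'_def using assms
    by (metis add_nonneg_pos add_pos_nonneg zero_le_power2 zero_less_norm_iff zero_less_power)+
  have "stereo (hpoint p q) \<bullet> stereo (hpoint p' q') =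
      (4 * ((p * cnj q) \<bullet> (p' * cnj q')) +
       ((cmod p)\<^sup>2 - (cmod q)\<^sup>2) * ((cmod p')\<^sup>2 - (cmod q')\<^sup>2)) / (N * N')"
    unfolding stereo_hpoint[OF assms(1)] stereo_hpoint[OF assms(2)]
    by (simp add: inner_Pair add_divide_distrib flip: N_def N'_def)
  then have "1 - stereo (hpoint p q) \<bullet> stereo (hpoint p' q') =
     (N * N' - (4 * ((p * cnj q) \<bullet> (p' * cnj q')) +
       ((cmod p)\<^sup>2 - (cmod q)\<^sup>2) * ((cmod p')\<^sup>2 - (cmod q')\<^sup>2))) / (N * N')"
    using N by (simp add: field_simps)
  also have "N * N' - (4 * ((p * cnj q) \<bullet> (p' * cnj q')) +
       ((cmod p)\<^sup>2 - (cmod q)\<^sup>2) * ((cmod p')\<^sup>2 - (cmod q')\<^sup>2)) = 2 * (cmod (p * q' - p' * q))\<^sup>2"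
    unfolding N_def N'_def cmod_power2 inner_complex_def
    by (simp add: algebra_simps power2_eq_square)
  finally show ?thesis by (simp add: N_def N'_def)
qed

lemma stereo_inner_le_1: "stereo p \<bullet> stereo q \<le> 1"
proof -
  obtain a b c d where "a \<noteq> 0 \<or> b \<noteq> 0" "p = hpoint a b" "c \<noteq> 0 \<or> d \<noteq> 0" "q = hpoint c d"
    by (metis hpoint_cases)
  then show ?thesis
    using chordal_formula[of a b c d] by (smt (verit) divide_nonneg_nonneg mult_nonneg_nonneg zero_le_power2)
qed

lemma norm_stereo [simp]: "norm (stereo p) = 1"
proof -
  obtain a b where "a \<noteq> 0 \<or> b \<noteq> 0" "p = hpoint a b" by (metis hpoint_cases)
  then have "stereo p \<bullet> stereo p = 1" using chordal_formula[of a b a b] by simp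
  then show ?thesis by (simp add: norm_eq_sqrt_inner)
qed

lemma stereo_inner_ge_m1: "- 1 \<le> stereo p \<bullet> stereo q"
  using Cauchy_Schwarz_ineq2[of "stereo p" "stereo q"] by simp

lemma stereo_inj: "stereo p = stereo q \<longleftrightarrow> p = q"
proof
  assume eq: "stereo p = stereo q"
  obtain a b c d where *: "a \<noteq> 0 \<or> b \<noteq> 0" "p = hpoint a b" "c \<noteq> 0 \<or> d \<noteq> 0" "q = hpoint c d"
    by (metis hpoint_cases)
  have "stereo p \<bullet> stereo q = 1" using eq norm_stereo[of q] by (simp add: norm_eq_sqrt_inner)
  moreover have "(cmod a)\<^sup>2 + (cmod b)\<^sup>2 > 0" "(cmod c)\<^sup>2 + (cmod d)\<^sup>2 > 0"
    using * by (metis add_nonneg_pos add_pos_nonneg zero_le_power2 zero_less_norm_iff zero_less_power)+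
  ultimately have "a * d - c * b = 0" using chordal_formula[of a b c d] * by auto
  then show "p = q" using * hpoint_eq_iff by simp
qed auto

text \<open>
  Both sides of the bound scale alike with the coordinates, so it holds for all representatives of the
  two points. That \<open>\<delta>\<close> depends on \<open>\<epsilon>\<close> only makes all later constants uniform in the family.
\<close>

lemma sph_dist_separated:
  assumes "\<epsilon> > 0"
  obtains \<delta> where "\<delta> > 0"
    "\<And>p q p' q'. \<lbrakk>p \<noteq> 0 \<or> q \<noteq> 0; p' \<noteq> 0 \<or> q' \<noteq> 0; \<epsilon> \<le> sph_dist (hpoint p q) (hpoint p' q')\<rbrakk> \<Longrightarrow>
      \<delta> * max (cmod p) (cmod q) * max (cmod p') (cmod q') \<le> cmod (p * q' - p' * q)"
proof
  define e where "e = min \<epsilon> pi"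
  have e: "0 < e" "e \<le> pi" "e \<le> \<epsilon>" using assms by (auto simp: e_def)
  define \<delta> where "\<delta> = sqrt ((1 - cos e) / 2)"
  have "cos e < cos 0" using e by (subst cos_mono_less_eq) auto
  then show "\<delta> > 0" by (simp add: \<delta>_def)
  fix p q p' q'
  assume *: "p \<noteq> 0 \<or> q \<noteq> 0" "p' \<noteq> 0 \<or> q' \<noteq> 0" "\<epsilon> \<le> sph_dist (hpoint p q) (hpoint p' q')"
  let ?t = "stereo (hpoint p q) \<bullet> stereo (hpoint p' q')"
  have t: "\<bar>?t\<bar> \<le> 1" using stereo_inner_le_1 stereo_inner_ge_m1 by (smt (verit))
  have "e \<le> arccos ?t" using * e by (simp add: sph_dist_def)
  then have "?t \<le> cos e"
    using t e arccos[of ?t] cos_monotone_0_pi_le[of e "arccos ?t"] by (auto simp: abs_le_iff)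
  then have d: "2 * \<delta>\<^sup>2 \<le> 1 - ?t" using \<open>\<delta> > 0\<close> by (simp add: \<delta>_def)
  define N N' where "N = (cmod p)\<^sup>2 + (cmod q)\<^sup>2" and "N' = (cmod p')\<^sup>2 + (cmod q')\<^sup>2"
  have N: "N > 0" "N' > 0" unfolding N_def N'_def using *
    by (metis add_nonneg_pos add_pos_nonneg zero_le_power2 zero_less_norm_iff zero_less_power)+
  define X where "X = (cmod (p * q' - p' * q))\<^sup>2"
  have eqn: "1 - ?t = 2 * X / (N * N')"
    using * chordal_formula by (simp add: N_def N'_def X_def)
  have "2 * \<delta>\<^sup>2 * (N * N') \<le> (1 - ?t) * (N * N')"
    using d N by (intro mult_right_mono) auto
  also have "\<dots> = 2 * X" unfolding eqn using N by simp
  finally have 1: "\<delta>\<^sup>2 * N * N' \<le> (cmod (p * q' - p' * q))\<^sup>2"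
    by (simp add: X_def mult.assoc)
  have mx: "(max (cmod x) (cmod y))\<^sup>2 \<le> (cmod x)\<^sup>2 + (cmod y)\<^sup>2" for x y
    by (auto simp: max_def)
  have "(\<delta> * max (cmod p) (cmod q) * max (cmod p') (cmod q'))\<^sup>2 \<le> \<delta>\<^sup>2 * N * N'"
    unfolding power_mult_distrib N_def N'_def
    by (intro mult_mono mx mult_left_mono) auto
  then show "\<delta> * max (cmod p) (cmod q) * max (cmod p') (cmod q') \<le> cmod (p * q' - p' * q)"
    using 1 power2_le_imp_le by (meson norm_ge_zero order_trans)
qed

text \<open>
  In applications one coordinate of each point is 1, and the determinant is the difference of the
  values in a chart: uniform convergence in a chart implies uniform convergence on the sphere.
\<close>

lemma sph_dist_less:
  assumes "e > 0"
  obtains \<eta> where "\<eta> > 0"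
    "\<And>p q p' q'. \<lbrakk>1 \<le> max (cmod p) (cmod q); 1 \<le> max (cmod p') (cmod q'); cmod (p * q' - p' * q) < \<eta>\<rbrakk>
       \<Longrightarrow> sph_dist (hpoint p q) (hpoint p' q') < e"
proof
  define d where "d = min e pi"
  have d: "0 < d" "d \<le> pi" "d \<le> e" using assms by (auto simp: d_def)
  define \<eta> where "\<eta> = sqrt ((1 - cos d) / 2)"
  have "cos d < cos 0" using d by (subst cos_mono_less_eq) auto
  then show "\<eta> > 0" by (simp add: \<eta>_def)
  fix p q p' q'
  assume *: "1 \<le> max (cmod p) (cmod q)" "1 \<le> max (cmod p') (cmod q')" "cmod (p * q' - p' * q) < \<eta>"
  then have nz: "p \<noteq> 0 \<or> q \<noteq> 0" "p' \<noteq> 0 \<or> q' \<noteq> 0" by auto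
  let ?t = "stereo (hpoint p q) \<bullet> stereo (hpoint p' q')"
  have t: "\<bar>?t\<bar> \<le> 1" using stereo_inner_le_1 stereo_inner_ge_m1 by (smt (verit))
  define N N' where "N = (cmod p)\<^sup>2 + (cmod q)\<^sup>2" and "N' = (cmod p')\<^sup>2 + (cmod q')\<^sup>2"
  have mx: "1 \<le> (cmod x)\<^sup>2 + (cmod y)\<^sup>2" if "1 \<le> max (cmod x) (cmod y)" for x y
    using that by (smt (verit) max_def one_le_power zero_le_power2)
  have "1 * 1 \<le> N * N'" unfolding N_def N'_def using * by (intro mult_mono mx) auto
  then have N: "1 \<le> N * N'" by simp
  have "1 - ?t = 2 * (cmod (p * q' - p' * q))\<^sup>2 / (N * N')"
    using nz chordal_formula by (simp add: N_def N'_def)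
  also have "\<dots> \<le> 2 * (cmod (p * q' - p' * q))\<^sup>2"
    using N by (simp add: divide_le_eq mult_left_le mult_le_cancel_left1)
  also have "\<dots> < 2 * \<eta>\<^sup>2" using * \<open>\<eta> > 0\<close> by (simp add: power_strict_mono)
  also have "\<dots> = 1 - cos d" using \<open>\<eta> > 0\<close> by (simp add: \<eta>_def)
  finally have "cos d < ?t" by simp
  then have "arccos ?t < arccos (cos d)" using t by (intro arccos_less_arccos) auto
  also have "\<dots> = d" using d by (intro arccos_cos) auto
  finally show "sph_dist (hpoint p q) (hpoint p' q') < e" using d by (simp add: sph_dist_def)
qed

text \<open>
  Limits are compared in Euclidean 3-space, where the sphere is embedded and limits are unique.
\<close>

lemma sph_dist_limit_unique:
  assumes "(\<lambda>n. sph_dist (s n) p) \<longlonglongrightarrow> 0" "(\<lambda>n. sph_dist (s n) q) \<longlonglongrightarrow> 0"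
  shows "p = q"
proof -
  have "(\<lambda>n. stereo (s n)) \<longlonglongrightarrow> stereo x" if "(\<lambda>n. sph_dist (s n) x) \<longlonglongrightarrow> 0" for x
  proof -
    have "(\<lambda>n. cos (sph_dist (s n) x)) \<longlonglongrightarrow> cos 0" using that by (intro tendsto_intros)
    moreover have "cos (sph_dist (s n) x) = stereo (s n) \<bullet> stereo x" for n
      unfolding sph_dist_def using stereo_inner_le_1 stereo_inner_ge_m1 by (simp add: cos_arccos)
    ultimately have "(\<lambda>n. stereo (s n) \<bullet> stereo x) \<longlonglongrightarrow> 1" by simp
    then have "(\<lambda>n. sqrt (2 - 2 * (stereo (s n) \<bullet> stereo x))) \<longlonglongrightarrow> sqrt (2 - 2 * 1)"
      by (intro tendsto_intros)
    moreover have "sqrt (2 - 2 * (stereo (s n) \<bullet> stereo x)) = norm (stereo (s n) - stereo x)" for n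
    proof (rule real_sqrt_unique)
      have "stereo x \<bullet> stereo x = 1" "stereo (s n) \<bullet> stereo (s n) = 1"
        by (simp_all flip: power2_norm_eq_inner)
      then show "(norm (stereo (s n) - stereo x))\<^sup>2 = 2 - 2 * (stereo (s n) \<bullet> stereo x)"
        by (simp add: power2_norm_eq_inner inner_diff_left inner_diff_right inner_commute)
    qed simp
    ultimately have "(\<lambda>n. norm (stereo (s n) - stereo x)) \<longlonglongrightarrow> 0" by simp
    then show ?thesis using Lim_null tendsto_norm_zero_iff by blast
  qed
  from this[OF assms(1)] this[OF assms(2)] show ?thesis
    using LIMSEQ_unique stereo_inj by blast
qed

section \<open>Holomorphic maps into the sphere and separated pairs\<close>

text \<open>
  Holomorphic maps into the sphere, the constant infinity included. The ratio is required only locally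
  because coordinates on the whole of \<open>A\<close> may be hard to come by (for a meromorphic function this would
  be a factorization theorem).
\<close>

definition sph_hol :: "(complex \<Rightarrow> csphere) \<Rightarrow> complex set \<Rightarrow> bool" where
  "sph_hol h A \<longleftrightarrow> (\<forall>z\<in>A. \<exists>r>0. \<exists>P Q. P holomorphic_on ball z r \<and> Q holomorphic_on ball z r \<and>
     (\<forall>w\<in>ball z r. (P w \<noteq> 0 \<or> Q w \<noteq> 0) \<and> h w = hpoint (P w) (Q w)))"

text \<open>
  On all of \<open>A\<close> the map stays in one and the same chart and is bounded there. A sequence that
  satisfies this with a common \<open>M\<close> is accessible to Montel's theorem.
\<close>

definition chart_bounded :: "real \<Rightarrow> (complex \<Rightarrow> csphere) \<Rightarrow> complex set \<Rightarrow> bool" where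
  "chart_bounded M h A \<longleftrightarrow> (\<exists>g. g holomorphic_on A \<and> (\<forall>z\<in>A. norm (g z) \<le> M) \<and>
     ((\<forall>z\<in>A. h z = Some (g z)) \<or> (\<forall>z\<in>A. h z = recip (g z))))"

lemma sph_holE:
  assumes "sph_hol h A" "z \<in> A"
  obtains r P Q where "r > 0" "P holomorphic_on ball z r" "Q holomorphic_on ball z r"
    "\<And>w. w \<in> ball z r \<Longrightarrow> P w \<noteq> 0 \<or> Q w \<noteq> 0" "\<And>w. w \<in> ball z r \<Longrightarrow> h w = hpoint (P w) (Q w)"
  using assms unfolding sph_hol_def by metis

lemma sph_hol_subset: "sph_hol h A \<Longrightarrow> B \<subseteq> A \<Longrightarrow> sph_hol h B"
  by (auto simp: sph_hol_def)

text \<open>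
  This is the Schwarz lemma for \<open>f - f z0\<close>. The factor 3 instead of 2 provides the strict inequality
  that the lemma asks for.
\<close>

lemma bounded_holomorphic_near_center:
  assumes f: "f holomorphic_on ball z0 R" and R: "R > 0" and K: "K > 0"
    and bd: "\<And>z. z \<in> ball z0 R \<Longrightarrow> norm (f z) \<le> K" and z: "z \<in> ball z0 R"
  shows "norm (f z - f z0) \<le> 3 * K / R * norm (z - z0)"
proof -
  define g where "g = (\<lambda>\<zeta>. (f (z0 + of_real R * \<zeta>) - f z0) / of_real (3 * K))"
  have sub: "z0 + of_real R * \<zeta> \<in> ball z0 R" if "norm \<zeta> < 1" for \<zeta>
    using that R by (simp add: dist_norm norm_mult)
  have "(\<lambda>\<zeta>. f (z0 + of_real R * \<zeta>)) holomorphic_on ball 0 1"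
    by (rule holomorphic_on_compose_gen[OF _ f, unfolded o_def])
       (use sub in \<open>auto intro!: holomorphic_intros\<close>)
  then have "g holomorphic_on ball 0 1"
    unfolding g_def using K by (intro holomorphic_intros) auto
  moreover have "g 0 = 0" by (simp add: g_def)
  moreover have "norm (g \<zeta>) < 1" if "norm \<zeta> < 1" for \<zeta>
  proof -
    have "norm (f (z0 + of_real R * \<zeta>) - f z0) \<le> K + K"
      using bd sub[OF that] R by (intro order_trans[OF norm_triangle_ineq4] add_mono) auto
    then show ?thesis using K by (simp add: g_def norm_divide norm_mult)
  qed
  moreover have "norm ((z - z0) / of_real R) < 1"
    using z R by (simp add: norm_divide dist_norm norm_minus_commute)
  ultimately have "norm (g ((z - z0) / of_real R)) \<le> norm ((z - z0) / of_real R)"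
    by (rule Schwarz_Lemma(1))
  then show ?thesis
    using R K by (simp add: g_def norm_divide norm_mult field_simps)
qed

text \<open>
  A coordinate that has modulus at least \<open>\<kappa>\<close> at the centre keeps modulus \<open>\<kappa>/2\<close> on the small disc, by
  the preceding estimate, and can be divided out there. So \<open>P\<close> and \<open>Q\<close> may vanish together elsewhere,
  where they say nothing about \<open>h\<close>.
\<close>

lemma chart_bounded_near_center:
  assumes P: "P holomorphic_on ball z0 R" and Q: "Q holomorphic_on ball z0 R"
    and R: "R > 0" and K: "K > 0"
    and bd: "\<And>z. z \<in> ball z0 R \<Longrightarrow> norm (P z) \<le> K" "\<And>z. z \<in> ball z0 R \<Longrightarrow> norm (Q z) \<le> K"
    and low: "\<kappa> > 0" "\<kappa> \<le> norm (P z0) \<or> \<kappa> \<le> norm (Q z0)"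
    and h: "\<And>z. z \<in> ball z0 R \<Longrightarrow> P z \<noteq> 0 \<or> Q z \<noteq> 0 \<Longrightarrow> h z = hpoint (P z) (Q z)"
    and \<rho>: "\<rho> \<le> R" "\<rho> \<le> \<kappa> * R / (6 * K)"
  shows "chart_bounded (2 * K / \<kappa>) h (ball z0 \<rho>)"
proof -
  have sub: "ball z0 \<rho> \<subseteq> ball z0 R" using \<rho> by auto
  have lower: "\<kappa> / 2 < norm (X z)"
    if X: "X holomorphic_on ball z0 R" "\<And>z. z \<in> ball z0 R \<Longrightarrow> norm (X z) \<le> K" "\<kappa> \<le> norm (X z0)"
      and z: "z \<in> ball z0 \<rho>" for X z
  proof -
    have "norm (X z - X z0) \<le> 3 * K / R * norm (z - z0)"
      using bounded_holomorphic_near_center[OF X(1) R K X(2)] z sub by blast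
    also have "\<dots> < 3 * K / R * (\<kappa> * R / (6 * K))"
      using z \<rho> R K by (intro mult_strict_left_mono) (auto simp: dist_norm norm_minus_commute)
    also have "\<dots> = \<kappa> / 2" using R K by simp
    finally show ?thesis using X(3) norm_triangle_ineq2[of "X z0" "X z"] norm_minus_commute[of "X z" "X z0"] by linarith
  qed
  have quot: "norm (Y z / X z) \<le> 2 * K / \<kappa>"
    if "\<kappa> / 2 < norm (X z)" "norm (Y z) \<le> K" for X Y :: "complex \<Rightarrow> complex" and z
  proof -
    have "norm (Y z / X z) \<le> K / (\<kappa> / 2)"
      unfolding norm_divide using that low K by (intro frac_le) auto
    then show ?thesis by (simp add: mult.commute)
  qed
  from low(2) show ?thesis
  proof
    assume "\<kappa> \<le> norm (P z0)"
    then have l: "\<kappa> / 2 < norm (P z)" if "z \<in> ball z0 \<rho>" for z using lower[OF P bd(1)] that by auto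
    then have nz: "P z \<noteq> 0" if "z \<in> ball z0 \<rho>" for z using that low by (metis norm_zero half_gt_zero_iff order.asym)
    show ?thesis unfolding chart_bounded_def
    proof (intro exI conjI ballI disjI2)
      show "(\<lambda>z. Q z / P z) holomorphic_on ball z0 \<rho>"
        using P Q sub nz by (intro holomorphic_intros) (auto intro: holomorphic_on_subset)
      show "norm (Q z / P z) \<le> 2 * K / \<kappa>" if "z \<in> ball z0 \<rho>" for z
        using quot l bd that sub by blast
      show "h z = recip (Q z / P z)" if "z \<in> ball z0 \<rho>" for z
        using h[of z] nz[OF that] that sub by (auto simp: hpoint_def recip_def)
    qed
  next
    assume "\<kappa> \<le> norm (Q z0)"
    then have l: "\<kappa> / 2 < norm (Q z)" if "z \<in> ball z0 \<rho>" for z using lower[OF Q bd(2)] that by auto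
    then have nz: "Q z \<noteq> 0" if "z \<in> ball z0 \<rho>" for z using that low by (metis norm_zero half_gt_zero_iff order.asym)
    show ?thesis unfolding chart_bounded_def
    proof (intro exI conjI ballI disjI1)
      show "(\<lambda>z. P z / Q z) holomorphic_on ball z0 \<rho>"
        using P Q sub nz by (intro holomorphic_intros) (auto intro: holomorphic_on_subset)
      show "norm (P z / Q z) \<le> 2 * K / \<kappa>" if "z \<in> ball z0 \<rho>" for z
        using quot l bd that sub by blast
      show "h z = Some (P z / Q z)" if "z \<in> ball z0 \<rho>" for z
        using h[of z] nz[OF that] that sub by (auto simp: hpoint_def)
    qed
  qed
qed

text \<open>
  A canonical choice of coordinates. With it, expressions of degree 0 in sphere-valued maps can be
  written globally, while their holomorphy is checked in local coordinates.
\<close>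

definition hnum :: "csphere \<Rightarrow> complex" where "hnum p = (case p of None \<Rightarrow> 1 | Some x \<Rightarrow> x)"
definition hden :: "csphere \<Rightarrow> complex" where "hden p = (case p of None \<Rightarrow> 0 | Some x \<Rightarrow> 1)"

lemma hpoint_hnum_hden: "hnum p \<noteq> 0 \<or> hden p \<noteq> 0" "hpoint (hnum p) (hden p) = p"
  by (cases p; simp add: hnum_def hden_def hpoint_def)+

lemma hnum_hden_hpoint:
  assumes "p \<noteq> 0 \<or> q \<noteq> 0"
  obtains c where "c \<noteq> 0" "p = c * hnum (hpoint p q)" "q = c * hden (hpoint p q)"
proof (cases "q = 0")
  case True
  then show ?thesis using assms that[of p] by (simp add: hnum_def hden_def hpoint_def)
next
  case False
  then show ?thesis using that[of q] by (simp add: hnum_def hden_def hpoint_def)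
qed

text \<open>
  The product of two spheres without its diagonal is an affine surface with the coordinates
  \<open>1/(a - b)\<close>, \<open>a/(a - b)\<close>, \<open>b/(a - b)\<close> and \<open>a b/(a - b)\<close>. Keeping away from the diagonal means that
  these are bounded. The second and the third differ by 1, so one of them has modulus at least 1/2 at the
  centre, and \<open>a\<close> can be recovered near the centre from
  \<open>a = [a/(a - b) : 1/(a - b)] = [a b/(a - b) : b/(a - b)]\<close>.
\<close>

lemma separated_imp_chart_bounded:
  assumes \<epsilon>: "\<epsilon> > 0" and R: "R > 0"
  obtains \<rho> M where "\<rho> > 0" "\<rho> \<le> R" "M > 0"
    "\<And>a b z0. \<lbrakk>sph_hol a (ball z0 R); sph_hol b (ball z0 R);
        \<And>z. z \<in> ball z0 R \<Longrightarrow> \<epsilon> \<le> sph_dist (a z) (b z)\<rbrakk> \<Longrightarrow> chart_bounded M a (ball z0 \<rho>)"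
proof -
  obtain \<delta> where \<delta>: "\<delta> > 0" and sep: "\<And>p q p' q'.
      \<lbrakk>p \<noteq> 0 \<or> q \<noteq> 0; p' \<noteq> 0 \<or> q' \<noteq> 0; \<epsilon> \<le> sph_dist (hpoint p q) (hpoint p' q')\<rbrakk> \<Longrightarrow>
      \<delta> * max (cmod p) (cmod q) * max (cmod p') (cmod q') \<le> cmod (p * q' - p' * q)"
    using sph_dist_separated[OF \<epsilon>] by blast
  define K where "K = 1 / \<delta>"
  have K: "K > 0" using \<delta> by (simp add: K_def)
  define \<rho> where "\<rho> = min R ((1/2) * R / (6 * K))"
  show thesis
  proof (rule that)
    show "\<rho> > 0" "\<rho> \<le> R" using R K by (auto simp: \<rho>_def)
    show "2 * K / (1/2) > 0" using K by simp
    fix a b z0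
    assume a: "sph_hol a (ball z0 R)" and b: "sph_hol b (ball z0 R)"
      and ab: "\<And>z. z \<in> ball z0 R \<Longrightarrow> \<epsilon> \<le> sph_dist (a z) (b z)"
    define d where "d z = hnum (a z) * hden (b z) - hnum (b z) * hden (a z)" for z
    \<comment> \<open>the four products of a homogeneous coordinate of a with one of b, over the determinant\<close>
    define u where "u z = hnum (a z) * hden (b z) / d z" for z
    define v where "v z = hden (a z) * hden (b z) / d z" for z
    define w where "w z = hnum (b z) * hden (a z) / d z" for z
    define t where "t z = hnum (a z) * hnum (b z) / d z" for z
    have loc: "\<exists>s>0. u holomorphic_on ball z s \<and> v holomorphic_on ball z s \<and>
                 w holomorphic_on ball z s \<and> t holomorphic_on ball z s" if z: "z \<in> ball z0 R" for z
    proof -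
      obtain r1 P1 Q1 where 1: "r1 > 0" "P1 holomorphic_on ball z r1" "Q1 holomorphic_on ball z r1"
        "\<And>w. w \<in> ball z r1 \<Longrightarrow> P1 w \<noteq> 0 \<or> Q1 w \<noteq> 0" "\<And>w. w \<in> ball z r1 \<Longrightarrow> a w = hpoint (P1 w) (Q1 w)"
        using sph_holE[OF a z] by blast
      obtain r2 P2 Q2 where 2: "r2 > 0" "P2 holomorphic_on ball z r2" "Q2 holomorphic_on ball z r2"
        "\<And>w. w \<in> ball z r2 \<Longrightarrow> P2 w \<noteq> 0 \<or> Q2 w \<noteq> 0" "\<And>w. w \<in> ball z r2 \<Longrightarrow> b w = hpoint (P2 w) (Q2 w)"
        using sph_holE[OF b z] by blast
      obtain r3 where 3: "r3 > 0" "ball z r3 \<subseteq> ball z0 R"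
        using z open_ball open_contains_ball by blast
      define s where "s = min r1 (min r2 r3)"
      have s: "s > 0" "ball z s \<subseteq> ball z r1" "ball z s \<subseteq> ball z r2" "ball z s \<subseteq> ball z0 R"
        using 1 2 3 by (auto simp: s_def)
      define D where "D x = P1 x * Q2 x - P2 x * Q1 x" for x
      have D: "D x \<noteq> 0" if x: "x \<in> ball z s" for x
      proof -
        have "0 < \<delta> * max (cmod (P1 x)) (cmod (Q1 x)) * max (cmod (P2 x)) (cmod (Q2 x))"
          using \<delta> 1(4)[of x] 2(4)[of x] x s by (auto simp: less_max_iff_disj intro!: mult_pos_pos)
        also have "\<dots> \<le> cmod (D x)"
        proof -
          have "x \<in> ball z r1" "x \<in> ball z r2" "x \<in> ball z0 R" using x s by blast+
          then show ?thesis unfolding D_def using 1(4,5)[of x] 2(4,5)[of x] ab[of x] by (intro sep) auto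
        qed
        finally show ?thesis by auto
      qed
      have eqs: "u x = P1 x * Q2 x / D x \<and> v x = Q1 x * Q2 x / D x \<and>
            w x = P2 x * Q1 x / D x \<and> t x = P1 x * P2 x / D x" if x: "x \<in> ball z s" for x
      proof -
        obtain c where c: "c \<noteq> 0" "P1 x = c * hnum (a x)" "Q1 x = c * hden (a x)"
          using hnum_hden_hpoint[of "P1 x" "Q1 x"] 1(4,5)[of x] x s by (metis subsetD)
        obtain e where e: "e \<noteq> 0" "P2 x = e * hnum (b x)" "Q2 x = e * hden (b x)"
          using hnum_hden_hpoint[of "P2 x" "Q2 x"] 2(4,5)[of x] x s by (metis subsetD)
        have "D x = (c * e) * d x" by (simp add: D_def d_def c e algebra_simps)
        moreover have "d x \<noteq> 0" using D[OF x] calculation by auto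
        ultimately show ?thesis using c(1) e(1) by (simp add: u_def v_def w_def t_def c e)
      qed
      have hD: "D holomorphic_on ball z s" "P1 holomorphic_on ball z s" "Q1 holomorphic_on ball z s"
        "P2 holomorphic_on ball z s" "Q2 holomorphic_on ball z s"
        unfolding D_def using 1(2,3) 2(2,3) s
        by (auto intro!: holomorphic_intros intro: holomorphic_on_subset)
      have "u holomorphic_on ball z s" "v holomorphic_on ball z s"
        "w holomorphic_on ball z s" "t holomorphic_on ball z s"
        by (rule holomorphic_transform[of "\<lambda>x. _ x / D x"],
            use eqs D hD in \<open>auto intro!: holomorphic_intros\<close>)+
      then show ?thesis using s(1) by blast
    qed
    then have hol: "u holomorphic_on ball z0 R" "v holomorphic_on ball z0 R"
        "w holomorphic_on ball z0 R" "t holomorphic_on ball z0 R"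
      by (meson analytic_imp_holomorphic analytic_on_def)+
    have dlow: "max (cmod (hnum (a z))) (cmod (hden (a z))) * max (cmod (hnum (b z))) (cmod (hden (b z)))
          \<le> K * cmod (d z)" "d z \<noteq> 0" if z: "z \<in> ball z0 R" for z
    proof -
      have *: "\<delta> * max (cmod (hnum (a z))) (cmod (hden (a z))) * max (cmod (hnum (b z))) (cmod (hden (b z)))
          \<le> cmod (d z)" unfolding d_def
        by (intro sep hpoint_hnum_hden(1)) (use ab[OF z] in \<open>simp add: hpoint_hnum_hden\<close>)
      then show "max (cmod (hnum (a z))) (cmod (hden (a z))) * max (cmod (hnum (b z))) (cmod (hden (b z)))
          \<le> K * cmod (d z)" using \<delta> by (simp add: K_def field_simps)
      have "0 < \<delta> * max (cmod (hnum (a z))) (cmod (hden (a z))) * max (cmod (hnum (b z))) (cmod (hden (b z)))"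
        using \<delta> hpoint_hnum_hden(1) by (auto simp: less_max_iff_disj intro!: mult_pos_pos)
      then show "d z \<noteq> 0" using * by auto
    qed
    have bound: "cmod (x * y / d z) \<le> K"
      if z: "z \<in> ball z0 R" and "cmod x \<le> max (cmod (hnum (a z))) (cmod (hden (a z)))"
        "cmod y \<le> max (cmod (hnum (b z))) (cmod (hden (b z)))" for x y z
    proof -
      have "cmod (x * y) \<le> K * cmod (d z)"
        unfolding norm_mult using that
        by (intro order_trans[OF mult_mono dlow(1)[OF z]]) (auto simp: le_max_iff_disj)
      then show ?thesis using dlow(2)[OF z] by (simp add: norm_divide divide_le_eq)
    qed
    have bd: "cmod (u z) \<le> K" "cmod (v z) \<le> K" "cmod (w z) \<le> K" "cmod (t z) \<le> K"
      if "z \<in> ball z0 R" for z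
      unfolding u_def v_def w_def t_def mult.commute[of "hnum (b z)"]
      by (auto intro!: bound that)
    have a_uv: "a z = hpoint (u z) (v z)" if z: "z \<in> ball z0 R" and nz: "u z \<noteq> 0 \<or> v z \<noteq> 0" for z
    proof -
      have "hden (b z) / d z \<noteq> 0" using nz by (auto simp: u_def v_def)
      then show ?thesis using hpoint_scale[of "hden (b z) / d z" "hnum (a z)" "hden (a z)"]
        by (simp add: u_def v_def hpoint_hnum_hden mult.commute)
    qed
    have a_tw: "a z = hpoint (t z) (w z)" if z: "z \<in> ball z0 R" and nz: "t z \<noteq> 0 \<or> w z \<noteq> 0" for z
    proof -
      have "hnum (b z) / d z \<noteq> 0" using nz by (auto simp: t_def w_def)
      then show ?thesis using hpoint_scale[of "hnum (b z) / d z" "hnum (a z)" "hden (a z)"]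
        by (simp add: t_def w_def hpoint_hnum_hden mult.commute)
    qed
    have "u z0 - w z0 = 1"
      using dlow(2)[of z0] R by (simp add: u_def w_def d_def flip: diff_divide_distrib)
    then have "1 \<le> cmod (u z0) + cmod (w z0)"
      using norm_triangle_ineq4[of "u z0" "w z0"] by simp
    then consider "1/2 \<le> cmod (u z0)" | "1/2 \<le> cmod (w z0)" by linarith
    then show "chart_bounded (2 * K / (1/2)) a (ball z0 \<rho>)"
    proof cases
      case 1
      show ?thesis
        by (rule chart_bounded_near_center[OF hol(1,2) R K bd(1,2)])
           (use 1 a_uv in \<open>auto simp: \<rho>_def\<close>)
    next
      case 2
      show ?thesis
        by (rule chart_bounded_near_center[OF hol(4,3) R K bd(4,3)])
           (use 2 a_tw in \<open>auto simp: \<rho>_def\<close>)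
    qed
  qed
qed

section \<open>Maps that avoid three separated functions\<close>

text \<open>
  The map \<open>\<zeta> \<mapsto> z0 + R exp (8 \<zeta> - 9)\<close> sends the unit disc into the punctured disc, and already the disc
  of radius 1/2 covers a full circle around \<open>z0\<close>, since \<open>pi/8 < 1/2\<close>. So one use of Schottky's theorem
  bounds \<open>\<phi>\<close> on this circle if \<open>|\<phi>| \<le> 1\<close> at one of its points, and otherwise it bounds \<open>1/\<phi>\<close>. The maximum
  principle extends the bound to the inside of the circle.
\<close>

lemma schottky_punctured:
  assumes R: "R > 0"
  obtains \<rho> M where "\<rho> > 0" "\<rho> \<le> R" "M \<ge> 1"
    "\<And>\<phi> z0. \<lbrakk>\<phi> holomorphic_on ball z0 R; \<And>z. z \<in> ball z0 R \<Longrightarrow> \<phi> z \<noteq> 0;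
        (\<forall>z\<in>ball z0 R. \<phi> z = 1) \<or> (\<forall>z\<in>ball z0 R - {z0}. \<phi> z \<noteq> 1)\<rbrakk> \<Longrightarrow>
       (\<forall>z\<in>ball z0 \<rho>. cmod (\<phi> z) \<le> M) \<or> (\<forall>z\<in>ball z0 \<rho>. cmod (inverse (\<phi> z)) \<le> M)"
proof -
  define \<rho> where "\<rho> = R * exp (-9)"
  define M where "M = exp (pi * exp (pi * (2 + 2 * 1 + 12 * (1/2) / (1 - 1/2))))"
  have \<rho>: "\<rho> > 0" "\<rho> < R" using R by (auto simp: \<rho>_def)
  have M: "M \<ge> 1" unfolding M_def by simp
  have main: "\<forall>z\<in>ball z0 \<rho>. cmod (\<psi> z) \<le> M"
    if hol: "\<psi> holomorphic_on ball z0 R"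
      and omit: "\<And>z. z \<in> ball z0 R - {z0} \<Longrightarrow> \<psi> z \<noteq> 0 \<and> \<psi> z \<noteq> 1"
      and le: "cmod (\<psi> (z0 + of_real \<rho>)) \<le> 1" for \<psi> z0
  proof -
    define e where "e \<zeta> = z0 + of_real R * exp (8 * \<zeta> - 9)" for \<zeta>
    have e: "e \<zeta> \<in> ball z0 R - {z0}" if "\<zeta> \<in> cball 0 1" for \<zeta>
    proof -
      have "Re \<zeta> \<le> 1" using that complex_Re_le_cmod[of \<zeta>] by simp
      then have "exp (8 * Re \<zeta> - 9) < 1" by simp
      then show ?thesis using R by (simp add: e_def dist_norm norm_mult)
    qed
    have g: "(\<lambda>\<zeta>. \<psi> (e \<zeta>)) holomorphic_on cball 0 1"
      by (rule holomorphic_on_compose_gen[OF _ hol, unfolded o_def])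
         (use e in \<open>auto simp: e_def intro!: holomorphic_intros\<close>)
    have circle: "cmod (\<psi> z) \<le> M" if "cmod (z - z0) = \<rho>" for z
    proof -
      define \<zeta> where "\<zeta> = \<i> * of_real (Arg (z - z0)) / 8"
      have "z - z0 = of_real \<rho> * exp (\<i> * of_real (Arg (z - z0)))"
        using that \<rho> Arg_eq[of "z - z0"] by force
      also have "\<dots> = of_real R * exp (8 * \<zeta> - 9)"
      proof -
        have "exp (8 * \<zeta> - 9) = exp (\<i> * of_real (Arg (z - z0)) + of_real (- 9))"
          by (simp add: \<zeta>_def)
        also have "\<dots> = exp (\<i> * of_real (Arg (z - z0))) * of_real (exp (- 9))"
          unfolding exp_add exp_of_real ..
        finally show ?thesis by (simp add: \<rho>_def)
      qed
      finally have z: "z = e \<zeta>" by (simp add: e_def algebra_simps)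
      have "\<bar>Arg (z - z0)\<bar> \<le> pi" using mpi_less_Arg[of "z - z0"] Arg_le_pi[of "z - z0"] by linarith
      then have "cmod \<zeta> \<le> 1/2" using pi_less_4 by (simp add: \<zeta>_def norm_mult)
      moreover have "cmod (\<psi> (e 0)) \<le> 1"
      proof -
        have "exp (- 9 :: complex) = of_real (exp (- 9))"
          using exp_of_real[of "- 9"] by simp
        then show ?thesis using le by (simp add: e_def \<rho>_def)
      qed
      ultimately have small: "cmod \<zeta> \<le> 1/2" "cmod (\<psi> (e 0)) \<le> 1" by simp_all
      show ?thesis
        unfolding z M_def
      proof (rule Schottky[OF g])
        show "\<not> (\<psi> (e \<xi>) = 0 \<or> \<psi> (e \<xi>) = 1)" if "\<xi> \<in> cball 0 1" for \<xi>
          using omit e[OF that] by blast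
      qed (use small in simp_all)
    qed
    show ?thesis
    proof
      fix z assume z: "z \<in> ball z0 \<rho>"
      show "cmod (\<psi> z) \<le> M"
      proof (rule maximum_modulus_frontier[of \<psi> "cball z0 \<rho>"])
        show "\<psi> holomorphic_on interior (cball z0 \<rho>)"
          using \<rho> by (intro holomorphic_on_subset[OF hol]) auto
        show "continuous_on (closure (cball z0 \<rho>)) \<psi>"
          using \<rho> by (intro holomorphic_on_imp_continuous_on holomorphic_on_subset[OF hol]) auto
      qed (use z \<rho> circle in \<open>auto simp: dist_norm norm_minus_commute\<close>)
    qed
  qed
  show thesis
  proof (rule that)
    show "\<rho> > 0" "\<rho> \<le> R" "M \<ge> 1" using \<rho> M by auto
    fix \<phi> z0
    assume hol: "\<phi> holomorphic_on ball z0 R" and nz: "\<And>z. z \<in> ball z0 R \<Longrightarrow> \<phi> z \<noteq> 0"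
      and one: "(\<forall>z\<in>ball z0 R. \<phi> z = 1) \<or> (\<forall>z\<in>ball z0 R - {z0}. \<phi> z \<noteq> 1)"
    have "z0 + of_real \<rho> \<in> ball z0 R" using \<rho> by (simp add: dist_norm)
    note nz' = nz[OF this]
    from one show "(\<forall>z\<in>ball z0 \<rho>. cmod (\<phi> z) \<le> M) \<or> (\<forall>z\<in>ball z0 \<rho>. cmod (inverse (\<phi> z)) \<le> M)"
    proof
      assume "\<forall>z\<in>ball z0 R. \<phi> z = 1"
      then show ?thesis using M \<rho> by auto
    next
      assume *: "\<forall>z\<in>ball z0 R - {z0}. \<phi> z \<noteq> 1"
      show ?thesis
      proof (cases "cmod (\<phi> (z0 + of_real \<rho>)) \<le> 1")
        case True
        then show ?thesis using main[OF hol] nz * by auto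
      next
        case False
        have "(\<lambda>z. inverse (\<phi> z)) holomorphic_on ball z0 R"
          using hol nz by (intro holomorphic_intros) auto
        moreover have "cmod (inverse (\<phi> (z0 + of_real \<rho>))) \<le> 1"
          using False nz' by (simp add: norm_inverse inverse_le_1_iff)
        ultimately show ?thesis using main[of "\<lambda>z. inverse (\<phi> z)" z0] nz *
          by (auto simp: inverse_eq_1_iff)
      qed
    qed
  qed
qed

lemma chart_boundedE:
  assumes "chart_bounded M h A"
  obtains P Q where "P holomorphic_on A" "Q holomorphic_on A"
    "\<And>z. z \<in> A \<Longrightarrow> cmod (P z) \<le> max 1 M" "\<And>z. z \<in> A \<Longrightarrow> cmod (Q z) \<le> max 1 M"
    "\<And>z. z \<in> A \<Longrightarrow> 1 \<le> max (cmod (P z)) (cmod (Q z))"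
    "\<And>z. z \<in> A \<Longrightarrow> h z = hpoint (P z) (Q z)"
proof -
  obtain g where g: "g holomorphic_on A" "\<forall>z\<in>A. norm (g z) \<le> M"
    and "(\<forall>z\<in>A. h z = Some (g z)) \<or> (\<forall>z\<in>A. h z = recip (g z))"
    using assms unfolding chart_bounded_def by blast
  then consider "\<forall>z\<in>A. h z = hpoint (g z) 1" | "\<forall>z\<in>A. h z = hpoint 1 (g z)"
    by (auto simp: hpoint_recip)
  then show thesis
  proof cases
    case 1
    then show ?thesis using g by (intro that[of g "\<lambda>_. 1"]) (auto simp: le_max_iff_disj)
  next
    case 2
    then show ?thesis using g by (intro that[of "\<lambda>_. 1" g]) (auto simp: le_max_iff_disj)
  qed
qed

text \<open>
  The cross ratio \<open>\<phi>\<close> of \<open>F\<close> with \<open>a\<close>, \<open>b\<close>, \<open>c\<close> takes the value 1, 0 or \<open>\<infinity>\<close> exactly where \<open>F\<close> meets \<open>a\<close>, \<open>b\<close>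
  or \<open>c\<close>. Hence \<open>\<phi>\<close> or \<open>1/\<phi>\<close> is bounded near \<open>z0\<close> by the preceding lemma. The three functions have bounded
  coordinates whose determinants are bounded away from 0, because the functions are separated; so
  inverting the cross ratio yields bounded coordinates for \<open>F\<close>, not both small at the centre.
\<close>

lemma omits_three_imp_chart_bounded:
  assumes \<epsilon>: "\<epsilon> > 0" and R: "R > 0"
  obtains \<rho> M where "\<rho> > 0" "\<rho> \<le> R" "M > 0"
    "\<And>F a b c z0. \<lbrakk>sph_hol F (ball z0 R); sph_hol a (ball z0 R); sph_hol b (ball z0 R); sph_hol c (ball z0 R);
        \<And>z. z \<in> ball z0 R \<Longrightarrow> \<epsilon> \<le> sph_dist (a z) (b z);
        \<And>z. z \<in> ball z0 R \<Longrightarrow> \<epsilon> \<le> sph_dist (b z) (c z);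
        \<And>z. z \<in> ball z0 R \<Longrightarrow> \<epsilon> \<le> sph_dist (c z) (a z);
        \<And>z. z \<in> ball z0 R \<Longrightarrow> F z \<noteq> b z; \<And>z. z \<in> ball z0 R \<Longrightarrow> F z \<noteq> c z;
        (\<forall>z\<in>ball z0 R. F z = a z) \<or> (\<forall>z\<in>ball z0 R - {z0}. F z \<noteq> a z)\<rbrakk>
      \<Longrightarrow> chart_bounded M F (ball z0 \<rho>)"
proof -
  obtain \<rho>1 M1 where \<rho>1: "\<rho>1 > 0" "\<rho>1 \<le> R" and M1: "M1 > 0"
    and cb: "\<And>a b z0. \<lbrakk>sph_hol a (ball z0 R); sph_hol b (ball z0 R);
        \<And>z. z \<in> ball z0 R \<Longrightarrow> \<epsilon> \<le> sph_dist (a z) (b z)\<rbrakk> \<Longrightarrow> chart_bounded M1 a (ball z0 \<rho>1)"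
    using separated_imp_chart_bounded[OF \<epsilon> R] by blast
  obtain \<delta> where \<delta>: "\<delta> > 0" and sep: "\<And>p q p' q'.
      \<lbrakk>p \<noteq> 0 \<or> q \<noteq> 0; p' \<noteq> 0 \<or> q' \<noteq> 0; \<epsilon> \<le> sph_dist (hpoint p q) (hpoint p' q')\<rbrakk> \<Longrightarrow>
      \<delta> * max (cmod p) (cmod q) * max (cmod p') (cmod q') \<le> cmod (p * q' - p' * q)"
    using sph_dist_separated[OF \<epsilon>] by blast
  obtain \<rho>2 M2 where \<rho>2: "\<rho>2 > 0" "\<rho>2 \<le> \<rho>1" and M2: "M2 \<ge> 1" and schottky:
    "\<And>\<phi> z0. \<lbrakk>\<phi> holomorphic_on ball z0 \<rho>1; \<And>z. z \<in> ball z0 \<rho>1 \<Longrightarrow> \<phi> z \<noteq> 0;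
        (\<forall>z\<in>ball z0 \<rho>1. \<phi> z = 1) \<or> (\<forall>z\<in>ball z0 \<rho>1 - {z0}. \<phi> z \<noteq> 1)\<rbrakk> \<Longrightarrow>
       (\<forall>z\<in>ball z0 \<rho>2. cmod (\<phi> z) \<le> M2) \<or> (\<forall>z\<in>ball z0 \<rho>2. cmod (inverse (\<phi> z)) \<le> M2)"
    using schottky_punctured[OF \<rho>1(1)] by blast
  define K where "K = max 1 M1"
  have K: "K \<ge> 1" by (simp add: K_def)
  define L where "L = (K * (2 * K * K) * M2 + K * (2 * K * K) * M2) / \<delta>"
  have L: "L > 0" using K M2 \<delta> by (simp add: L_def)
  define \<kappa> where "\<kappa> = \<delta> / (2 * K)"
  have \<kappa>: "\<kappa> > 0" using K \<delta> by (simp add: \<kappa>_def)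
  define \<rho> where "\<rho> = min \<rho>2 (\<kappa> * \<rho>2 / (6 * L))"
  show thesis
  proof (rule that)
    show "\<rho> > 0" "\<rho> \<le> R" "2 * L / \<kappa> > 0" using \<rho>1 \<rho>2 \<kappa> L by (auto simp: \<rho>_def)
    fix F a b c z0
    assume hol: "sph_hol F (ball z0 R)" "sph_hol a (ball z0 R)" "sph_hol b (ball z0 R)" "sph_hol c (ball z0 R)"
      and ab: "\<And>z. z \<in> ball z0 R \<Longrightarrow> \<epsilon> \<le> sph_dist (a z) (b z)"
      and bc: "\<And>z. z \<in> ball z0 R \<Longrightarrow> \<epsilon> \<le> sph_dist (b z) (c z)"
      and ca: "\<And>z. z \<in> ball z0 R \<Longrightarrow> \<epsilon> \<le> sph_dist (c z) (a z)"
      and Fb: "\<And>z. z \<in> ball z0 R \<Longrightarrow> F z \<noteq> b z" and Fc: "\<And>z. z \<in> ball z0 R \<Longrightarrow> F z \<noteq> c z"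
      and Fa: "(\<forall>z\<in>ball z0 R. F z = a z) \<or> (\<forall>z\<in>ball z0 R - {z0}. F z \<noteq> a z)"
    let ?B = "ball z0 \<rho>1"
    have sub: "?B \<subseteq> ball z0 R" "ball z0 \<rho>2 \<subseteq> ?B" using \<rho>1 \<rho>2 by auto
    obtain p1 q1 where 1: "p1 holomorphic_on ?B" "q1 holomorphic_on ?B"
      "\<And>z. z \<in> ?B \<Longrightarrow> cmod (p1 z) \<le> K" "\<And>z. z \<in> ?B \<Longrightarrow> cmod (q1 z) \<le> K"
      "\<And>z. z \<in> ?B \<Longrightarrow> 1 \<le> max (cmod (p1 z)) (cmod (q1 z))" "\<And>z. z \<in> ?B \<Longrightarrow> a z = hpoint (p1 z) (q1 z)"
      using chart_boundedE[OF cb[OF hol(2,3) ab]] unfolding K_def by metis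
    obtain p2 q2 where 2: "p2 holomorphic_on ?B" "q2 holomorphic_on ?B"
      "\<And>z. z \<in> ?B \<Longrightarrow> cmod (p2 z) \<le> K" "\<And>z. z \<in> ?B \<Longrightarrow> cmod (q2 z) \<le> K"
      "\<And>z. z \<in> ?B \<Longrightarrow> 1 \<le> max (cmod (p2 z)) (cmod (q2 z))" "\<And>z. z \<in> ?B \<Longrightarrow> b z = hpoint (p2 z) (q2 z)"
      using chart_boundedE[OF cb[OF hol(3,4) bc]] unfolding K_def by metis
    obtain p3 q3 where 3: "p3 holomorphic_on ?B" "q3 holomorphic_on ?B"
      "\<And>z. z \<in> ?B \<Longrightarrow> cmod (p3 z) \<le> K" "\<And>z. z \<in> ?B \<Longrightarrow> cmod (q3 z) \<le> K"
      "\<And>z. z \<in> ?B \<Longrightarrow> 1 \<le> max (cmod (p3 z)) (cmod (q3 z))" "\<And>z. z \<in> ?B \<Longrightarrow> c z = hpoint (p3 z) (q3 z)"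
      using chart_boundedE[OF cb[OF hol(4,2) ca]] unfolding K_def by metis
    have lower: "\<delta> \<le> cmod (p * q' - p' * q)"
      if "1 \<le> max (cmod p) (cmod q)" "1 \<le> max (cmod p') (cmod q')"
        "\<epsilon> \<le> sph_dist (hpoint p q) (hpoint p' q')" for p q p' q'
    proof -
      have "1 * 1 \<le> max (cmod p) (cmod q) * max (cmod p') (cmod q')"
        using that by (intro mult_mono) auto
      then have "\<delta> * 1 \<le> \<delta> * (max (cmod p) (cmod q) * max (cmod p') (cmod q'))"
        using \<delta> by (intro mult_left_mono) auto
      also have "\<dots> \<le> cmod (p * q' - p' * q)"
        unfolding mult.assoc[symmetric] using that by (intro sep) auto
      finally show ?thesis by simp
    qed
    have upper: "cmod (p * q' - p' * q) \<le> 2 * K * K"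
      if "cmod p \<le> K" "cmod q \<le> K" "cmod p' \<le> K" "cmod q' \<le> K" for p q p' q'
    proof -
      have "cmod (p * q' - p' * q) \<le> K * K + K * K"
        using that K by (intro order_trans[OF norm_triangle_ineq4] add_mono) (auto simp: norm_mult intro!: mult_mono)
      then show ?thesis by simp
    qed
    define d12 where "d12 z = p1 z * q2 z - p2 z * q1 z" for z
    define d13 where "d13 z = p1 z * q3 z - p3 z * q1 z" for z
    define d23 where "d23 z = p2 z * q3 z - p3 z * q2 z" for z
    have d: "\<delta> \<le> cmod (d12 z)" "\<delta> \<le> cmod (d13 z)" "\<delta> \<le> cmod (d23 z)"
      "cmod (d12 z) \<le> 2 * K * K" "cmod (d13 z) \<le> 2 * K * K" if "z \<in> ?B" for z
    proof -
      have z: "z \<in> ball z0 R" using that sub by blast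
      show "\<delta> \<le> cmod (d12 z)" unfolding d12_def
        using ab[OF z] 1(5,6)[OF that] 2(5,6)[OF that] by (intro lower) simp_all
      have "\<delta> \<le> cmod (p3 z * q1 z - p1 z * q3 z)"
        using ca[OF z] 1(5,6)[OF that] 3(5,6)[OF that] by (intro lower) simp_all
      then show "\<delta> \<le> cmod (d13 z)" unfolding d13_def by (simp add: norm_minus_commute)
      show "\<delta> \<le> cmod (d23 z)" unfolding d23_def
        using bc[OF z] 2(5,6)[OF that] 3(5,6)[OF that] by (intro lower) simp_all
      show "cmod (d12 z) \<le> 2 * K * K" "cmod (d13 z) \<le> 2 * K * K" unfolding d12_def d13_def
        using 1 2 3 that by (auto intro!: upper)
    qed
    have dnz: "d12 z \<noteq> 0" "d13 z \<noteq> 0" "d23 z \<noteq> 0" if "z \<in> ?B" for z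
      using d[OF that] \<delta> by auto
    have dhol: "d12 holomorphic_on ?B" "d13 holomorphic_on ?B" "d23 holomorphic_on ?B"
      unfolding d12_def d13_def d23_def using 1 2 3 by (auto intro!: holomorphic_intros)
    \<comment> \<open>\<open>A\<close> and \<open>C\<close> vanish exactly where \<open>F\<close> meets \<open>b\<close> and \<open>c\<close>\<close>
    define A where "A z = hnum (F z) * q2 z - p2 z * hden (F z)" for z
    define C where "C z = hnum (F z) * q3 z - p3 z * hden (F z)" for z
    have eq0: "F z = hpoint p q \<longleftrightarrow> hnum (F z) * q - p * hden (F z) = 0" if "p \<noteq> 0 \<or> q \<noteq> 0" for p q z
      using hpoint_eq_iff[OF hpoint_hnum_hden(1)[of "F z"] that] by (simp add: hpoint_hnum_hden)
    have nz: "p1 z \<noteq> 0 \<or> q1 z \<noteq> 0" "p2 z \<noteq> 0 \<or> q2 z \<noteq> 0" "p3 z \<noteq> 0 \<or> q3 z \<noteq> 0" if "z \<in> ?B" for z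
      using 1(5)[OF that] 2(5)[OF that] 3(5)[OF that] by auto
    have AC: "A z \<noteq> 0" "C z \<noteq> 0" if "z \<in> ?B" for z
      unfolding A_def C_def using eq0 nz[OF that] Fb[of z] Fc[of z] 2(6)[OF that] 3(6)[OF that] that sub
      by (metis subsetD)+
    \<comment> \<open>the cross ratio of F and the three functions\<close>
    define \<phi> where "\<phi> z = A z * d13 z / (C z * d12 z)" for z
    have \<phi>_nz: "\<phi> z \<noteq> 0" if "z \<in> ?B" for z
      using AC[OF that] dnz[OF that] by (simp add: \<phi>_def)
    have \<phi>_1: "\<phi> z = 1 \<longleftrightarrow> F z = a z" if z: "z \<in> ?B" for z
    proof -
      have "\<phi> z = 1 \<longleftrightarrow> A z * d13 z - C z * d12 z = 0"
        using AC[OF z] dnz[OF z] by (auto simp: \<phi>_def divide_simps)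
      also have "A z * d13 z - C z * d12 z = d23 z * (hnum (F z) * q1 z - p1 z * hden (F z))"
        by (simp add: A_def C_def d13_def d12_def d23_def algebra_simps)
      also have "\<dots> = 0 \<longleftrightarrow> F z = a z"
        using dnz[OF z] eq0[OF nz(1)[OF z]] 1(6)[OF z] by simp
      finally show ?thesis .
    qed
    have \<phi>_hol: "\<phi> holomorphic_on ?B"
    proof -
      have "\<exists>s>0. \<phi> holomorphic_on ball z s" if z: "z \<in> ?B" for z
      proof -
        obtain r P Q where r: "r > 0" "P holomorphic_on ball z r" "Q holomorphic_on ball z r"
          "\<And>w. w \<in> ball z r \<Longrightarrow> P w \<noteq> 0 \<or> Q w \<noteq> 0" "\<And>w. w \<in> ball z r \<Longrightarrow> F w = hpoint (P w) (Q w)"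
          using sph_holE[OF hol(1), of z] z sub by blast
        obtain r' where r': "r' > 0" "ball z r' \<subseteq> ?B"
          using z open_ball open_contains_ball by blast
        define s where "s = min r r'"
        have s: "s > 0" "ball z s \<subseteq> ball z r" "ball z s \<subseteq> ?B" using r r' by (auto simp: s_def)
        define U where "U w = P w * q2 w - p2 w * Q w" for w
        define V where "V w = P w * q3 w - p3 w * Q w" for w
        have *: "V w \<noteq> 0 \<and> \<phi> w = U w * d13 w / (V w * d12 w)" if w: "w \<in> ball z s" for w
        proof -
          have w': "w \<in> ball z r" "w \<in> ?B" using w s by blast+
          obtain c where c: "c \<noteq> 0" "P w = c * hnum (F w)" "Q w = c * hden (F w)"
            using hnum_hden_hpoint[OF r(4)[OF w'(1)]] r(5)[OF w'(1)] by metis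
          have "U w = c * A w" "V w = c * C w"
            by (simp_all add: U_def V_def A_def C_def c algebra_simps)
          then show ?thesis using c(1) AC[OF w'(2)] by (simp add: \<phi>_def)
        qed
        have "(\<lambda>w. U w * d13 w / (V w * d12 w)) holomorphic_on ball z s"
          unfolding U_def[abs_def]
        proof (intro holomorphic_intros)
          show "V holomorphic_on ball z s"
            unfolding V_def[abs_def] using r(2,3) 3(1,2) s
            by (auto intro!: holomorphic_intros intro: holomorphic_on_subset)
        qed (use r(2,3) 2(1,2) dhol s * dnz in \<open>auto intro: holomorphic_on_subset\<close>)
        then have "\<phi> holomorphic_on ball z s"
          by (rule holomorphic_transform) (use * in auto)
        then show ?thesis using s(1) by blast
      qed
      then show ?thesis by (meson analytic_imp_holomorphic analytic_on_def)
    qed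
    \<comment> \<open>the cross ratio is \<open>t / s\<close>; taking \<open>(s, t)\<close> as \<open>(1, \<phi>)\<close> or \<open>(1/\<phi>, 1)\<close> treats both cases of the bound\<close>
    have key: "chart_bounded (2 * L / \<kappa>) F (ball z0 \<rho>)"
      if st: "s holomorphic_on ball z0 \<rho>2" "t holomorphic_on ball z0 \<rho>2"
        "\<And>z. z \<in> ball z0 \<rho>2 \<Longrightarrow> cmod (s z) \<le> M2" "\<And>z. z \<in> ball z0 \<rho>2 \<Longrightarrow> cmod (t z) \<le> M2"
        "(\<forall>z. s z = 1) \<or> (\<forall>z. t z = 1)"
        "\<And>z. z \<in> ball z0 \<rho>2 \<Longrightarrow> A z * d13 z * s z = C z * d12 z * t z" for s t
    proof -
      \<comment> \<open>the solution of the linear system in \<open>XY\<close> below (Cramer's rule)\<close>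
      define X where "X z = (p2 z * d13 z * s z - p3 z * d12 z * t z) / d23 z" for z
      define Y where "Y z = (q2 z * d13 z * s z - q3 z * d12 z * t z) / d23 z" for z
      have bd: "cmod ((x * d13 z * s z - y * d12 z * t z) / d23 z) \<le> L"
        if "z \<in> ball z0 \<rho>2" "cmod x \<le> K" "cmod y \<le> K" for x y z
      proof -
        have z: "z \<in> ?B" using that sub by blast
        have "cmod (x * d13 z * s z - y * d12 z * t z) \<le> K * (2 * K * K) * M2 + K * (2 * K * K) * M2"
          using that st d[OF z] K M2
          by (intro order_trans[OF norm_triangle_ineq4] add_mono) (auto simp: norm_mult intro!: mult_mono)
        then show ?thesis unfolding L_def norm_divide
          using d[OF z] \<delta> K M2 by (intro frac_le) auto
      qed
      have XY: "X z * q3 z - Y z * p3 z = d13 z * s z" "X z * q2 z - Y z * p2 z = d12 z * t z"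
        if "z \<in> ?B" for z
      proof -
        have "X z * q3 z - Y z * p3 z = ((p2 z * d13 z * s z - p3 z * d12 z * t z) * q3 z
            - (q2 z * d13 z * s z - q3 z * d12 z * t z) * p3 z) / d23 z"
          unfolding X_def Y_def by (simp only: times_divide_eq_left times_divide_eq_right diff_divide_distrib[symmetric])
        also have "\<dots> = d13 z * s z * d23 z / d23 z" by (simp add: d23_def algebra_simps)
        finally show "X z * q3 z - Y z * p3 z = d13 z * s z" using dnz[OF that] by simp
        have "X z * q2 z - Y z * p2 z = ((p2 z * d13 z * s z - p3 z * d12 z * t z) * q2 z
            - (q2 z * d13 z * s z - q3 z * d12 z * t z) * p2 z) / d23 z"
          unfolding X_def Y_def by (simp only: times_divide_eq_left times_divide_eq_right diff_divide_distrib[symmetric])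
        also have "\<dots> = d12 z * t z * d23 z / d23 z" by (simp add: d23_def algebra_simps)
        finally show "X z * q2 z - Y z * p2 z = d12 z * t z" using dnz[OF that] by simp
      qed
      have z0: "z0 \<in> ?B" using \<rho>1 by simp
      \<comment> \<open>one of \<open>s\<close>, \<open>t\<close> is 1, so one right-hand side of \<open>XY\<close> has modulus at least \<open>\<delta>\<close>\<close>
      have low: "\<kappa> \<le> cmod (X z0) \<or> \<kappa> \<le> cmod (Y z0)"
      proof (rule ccontr)
        assume "\<not> ?thesis"
        then have small: "cmod (X z0) < \<kappa>" "cmod (Y z0) < \<kappa>" by auto
        have less: "cmod (X z0 * q - Y z0 * p) < \<delta>" if pq: "cmod q \<le> K" "cmod p \<le> K" for p q
        proof -
          have "cmod (X z0 * q - Y z0 * p) \<le> cmod (X z0) * K + cmod (Y z0) * K"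
            using pq by (intro order_trans[OF norm_triangle_ineq4] add_mono) (auto simp: norm_mult intro!: mult_left_mono)
          also have "\<dots> < \<kappa> * K + \<kappa> * K" using small K by (intro add_strict_mono mult_strict_right_mono) auto
          also have "\<dots> = \<delta>" using K by (simp add: \<kappa>_def)
          finally show ?thesis .
        qed
        from st(5) show False
          using less[OF 3(4,3)[OF z0]] less[OF 2(4,3)[OF z0]] XY[OF z0] d[OF z0] by auto
      qed
      show ?thesis
      proof (rule chart_bounded_near_center[of X z0 \<rho>2 Y])
        note hol' = 2(1,2)[THEN holomorphic_on_subset, OF sub(2)] 3(1,2)[THEN holomorphic_on_subset, OF sub(2)]
          dhol[THEN holomorphic_on_subset, OF sub(2)]
        have "d23 z \<noteq> 0" if "z \<in> ball z0 \<rho>2" for z using dnz(3) that sub by blast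
        then show "X holomorphic_on ball z0 \<rho>2" "Y holomorphic_on ball z0 \<rho>2"
          unfolding X_def[abs_def] Y_def[abs_def] by (intro holomorphic_intros st(1,2) hol'; assumption)+
        show "cmod (X z) \<le> L" "cmod (Y z) \<le> L" if "z \<in> ball z0 \<rho>2" for z
          unfolding X_def Y_def using that subsetD[OF sub(2) that] by (simp_all only: bd 2 3)
        show "F z = hpoint (X z) (Y z)" if z: "z \<in> ball z0 \<rho>2" and nzz: "X z \<noteq> 0 \<or> Y z \<noteq> 0" for z
        proof -
          have "hnum (F z) * Y z - X z * hden (F z) = (A z * d13 z * s z - C z * d12 z * t z) / d23 z"
          proof -
            have "hnum (F z) * Y z - X z * hden (F z) = (hnum (F z) * (q2 z * d13 z * s z - q3 z * d12 z * t z)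
              - (p2 z * d13 z * s z - p3 z * d12 z * t z) * hden (F z)) / d23 z"
              unfolding X_def Y_def by (simp only: times_divide_eq_left times_divide_eq_right diff_divide_distrib[symmetric])
            then show ?thesis by (simp add: A_def C_def algebra_simps)
          qed
          then show ?thesis using eq0[OF nzz] st(6)[OF z] by simp
        qed
      qed (use \<rho>2 L \<kappa> low in \<open>auto simp: \<rho>_def\<close>)
    qed
    have "(\<forall>z\<in>ball z0 \<rho>2. cmod (\<phi> z) \<le> M2) \<or> (\<forall>z\<in>ball z0 \<rho>2. cmod (inverse (\<phi> z)) \<le> M2)"
    proof (rule schottky[OF \<phi>_hol \<phi>_nz])
      show "(\<forall>z\<in>?B. \<phi> z = 1) \<or> (\<forall>z\<in>?B - {z0}. \<phi> z \<noteq> 1)"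
        using Fa \<phi>_1 sub by (metis DiffD1 DiffD2 DiffI subsetD)
    qed
    then show "chart_bounded (2 * L / \<kappa>) F (ball z0 \<rho>)"
    proof
      assume le: "\<forall>z\<in>ball z0 \<rho>2. cmod (\<phi> z) \<le> M2"
      show ?thesis
      proof (rule key[of "\<lambda>_. 1" \<phi>])
        show "\<phi> holomorphic_on ball z0 \<rho>2" by (rule holomorphic_on_subset[OF \<phi>_hol sub(2)])
        show "A z * d13 z * 1 = C z * d12 z * \<phi> z" if "z \<in> ball z0 \<rho>2" for z
          using AC(2) dnz(1) subsetD[OF sub(2) that] by (simp add: \<phi>_def)
      qed (use M2 le in simp_all)
    next
      assume le: "\<forall>z\<in>ball z0 \<rho>2. cmod (inverse (\<phi> z)) \<le> M2"
      show ?thesis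
      proof (rule key[of "\<lambda>z. inverse (\<phi> z)" "\<lambda>_. 1"])
        show "(\<lambda>z. inverse (\<phi> z)) holomorphic_on ball z0 \<rho>2"
          using \<phi>_nz sub by (intro holomorphic_on_inverse holomorphic_on_subset[OF \<phi>_hol sub(2)]) blast
        show "A z * d13 z * inverse (\<phi> z) = C z * d12 z * 1" if "z \<in> ball z0 \<rho>2" for z
          using AC(1) dnz(2) subsetD[OF sub(2) that] by (simp add: \<phi>_def)
      qed (use M2 le in simp_all)
    qed
  qed
qed

section \<open>Meromorphic maps and a bounded derivative\<close>

lemma sph_hol_cong:
  assumes "sph_hol h A" "open A" "\<And>z. z \<in> A \<Longrightarrow> h z = h' z"
  shows "sph_hol h' A"
  unfolding sph_hol_def
proof
  fix z assume z: "z \<in> A"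
  obtain r P Q where r: "r > 0" "P holomorphic_on ball z r" "Q holomorphic_on ball z r"
    "\<And>w. w \<in> ball z r \<Longrightarrow> P w \<noteq> 0 \<or> Q w \<noteq> 0" "\<And>w. w \<in> ball z r \<Longrightarrow> h w = hpoint (P w) (Q w)"
    using sph_holE[OF assms(1) z] by blast
  obtain r' where r': "r' > 0" "ball z r' \<subseteq> A" using z assms(2) open_contains_ball by blast
  have sub: "ball z (min r r') \<subseteq> ball z r" "ball z (min r r') \<subseteq> A" using r' by auto
  show "\<exists>r>0. \<exists>P Q. P holomorphic_on ball z r \<and> Q holomorphic_on ball z r \<and>
     (\<forall>w\<in>ball z r. (P w \<noteq> 0 \<or> Q w \<noteq> 0) \<and> h' w = hpoint (P w) (Q w))"
  proof (intro exI conjI ballI)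
    show "min r r' > 0" using r r' by simp
    show "P holomorphic_on ball z (min r r')" "Q holomorphic_on ball z (min r r')"
      using r sub by (auto intro: holomorphic_on_subset)
    fix w assume w: "w \<in> ball z (min r r')"
    show "P w \<noteq> 0 \<or> Q w \<noteq> 0" "h' w = hpoint (P w) (Q w)"
      using r(4,5)[of w] assms(3)[of w] w sub by auto
  qed
qed

lemma sph_hol_Some: "g holomorphic_on A \<Longrightarrow> open A \<Longrightarrow> sph_hol (\<lambda>z. Some (g z)) A"
  unfolding sph_hol_def
proof
  fix z assume g: "g holomorphic_on A" "open A" "z \<in> A"
  then obtain r where "r > 0" "ball z r \<subseteq> A" using open_contains_ball by blast
  with g show "\<exists>r>0. \<exists>P Q. P holomorphic_on ball z r \<and> Q holomorphic_on ball z r \<and>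
     (\<forall>w\<in>ball z r. (P w \<noteq> 0 \<or> Q w \<noteq> 0) \<and> Some (g w) = hpoint (P w) (Q w))"
    by (intro exI[of _ r] conjI exI[of _ g] exI[of _ "\<lambda>_. 1"]) (auto intro: holomorphic_on_subset)
qed

lemma sph_hol_recip: "g holomorphic_on A \<Longrightarrow> open A \<Longrightarrow> sph_hol (\<lambda>z. recip (g z)) A"
  unfolding sph_hol_def
proof
  fix z assume g: "g holomorphic_on A" "open A" "z \<in> A"
  then obtain r where "r > 0" "ball z r \<subseteq> A" using open_contains_ball by blast
  with g show "\<exists>r>0. \<exists>P Q. P holomorphic_on ball z r \<and> Q holomorphic_on ball z r \<and>
     (\<forall>w\<in>ball z r. (P w \<noteq> 0 \<or> Q w \<noteq> 0) \<and> recip (g w) = hpoint (P w) (Q w))"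
    by (intro exI[of _ r] conjI exI[of _ g] exI[of _ "\<lambda>_. 1"])
       (auto intro: holomorphic_on_subset simp: hpoint_recip)
qed

text \<open>
  At a pole the coordinates are \<open>[1 : 1/F]\<close>.
\<close>

lemma sph_hol_to_sphere:
  assumes "\<And>z. z \<in> A \<Longrightarrow> \<exists>r>0. F holomorphic_on ball z r \<or> (is_pole F z \<and> F holomorphic_on ball z r - {z})"
  shows "sph_hol (to_sphere F) A"
  unfolding sph_hol_def
proof
  fix z assume "z \<in> A"
  then obtain r where r: "r > 0" and "F holomorphic_on ball z r \<or> (is_pole F z \<and> F holomorphic_on ball z r - {z})"
    using assms by blast
  then show "\<exists>r>0. \<exists>P Q. P holomorphic_on ball z r \<and> Q holomorphic_on ball z r \<and>
     (\<forall>w\<in>ball z r. (P w \<noteq> 0 \<or> Q w \<noteq> 0) \<and> to_sphere F w = hpoint (P w) (Q w))"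
  proof (elim disjE conjE)
    assume F: "F holomorphic_on ball z r"
    then have "\<not> is_pole F w" if "w \<in> ball z r" for w
      using not_is_pole_holomorphic open_ball that by blast
    with F r show ?thesis
      by (intro exI[of _ r] conjI exI[of _ F] exI[of _ "\<lambda>_. 1"]) (auto simp: to_sphere_def)
  next
    assume F: "is_pole F z" "F holomorphic_on ball z r - {z}"
    obtain d where d: "d > 0" "\<And>w. w \<noteq> z \<Longrightarrow> dist w z < d \<Longrightarrow> F w \<noteq> 0"
      using non_zero_neighbour_pole[OF F(1)] by (auto simp: eventually_at)
    define s where "s = min r d"
    have s: "s > 0" "ball z s \<subseteq> ball z r" "ball z s \<subseteq> ball z d" using r d by (auto simp: s_def)
    have F': "F holomorphic_on ball z s - {z}" using F(2) s by (auto intro: holomorphic_on_subset)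
    have nz: "\<forall>x\<in>ball z s - {z}. F x \<noteq> 0" using d s by (auto simp: dist_commute)
    have np: "\<not> is_pole F w" if "w \<in> ball z s - {z}" for w
      using not_is_pole_holomorphic[OF _ that F'] by (simp add: open_delete)
    define Q where "Q x = (if x = z then 0 else inverse (F x))" for x
    have "Q holomorphic_on ball z s"
      unfolding Q_def[abs_def] by (rule is_pole_inverse_holomorphic[OF open_ball F' F(1) nz])
    moreover have "to_sphere F w = hpoint 1 (Q w)" if "w \<in> ball z s" for w
      using that F(1) nz np by (auto simp: Q_def to_sphere_def hpoint_def field_simps)
    ultimately show ?thesis using s(1)
      by (intro exI[of _ s] conjI exI[of _ "\<lambda>_. 1"] exI[of _ Q]) auto
  qed
qed

text \<open>
  The two local pictures of a meromorphic map. In the second one the radius is small enough for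
  the reciprocal to be holomorphic as well.
\<close>

lemma mero_map_on_cases:
  assumes h: "mero_map_on h A" and A: "open A" "z \<in> A"
  obtains (finite) r where "r > 0" "ball z r \<subseteq> A" "finite_part h holomorphic_on ball z r"
      "\<And>w. w \<in> ball z r \<Longrightarrow> h w = Some (finite_part h w)"
  | (pole) r where "r > 0" "ball z r \<subseteq> A" "is_pole (finite_part h) z" "h z = None"
      "finite_part h holomorphic_on ball z r - {z}"
      "\<And>w. w \<in> ball z r - {z} \<Longrightarrow> h w = Some (finite_part h w) \<and> finite_part h w \<noteq> 0"
proof -
  let ?f = "finite_part h"
  have nm: "?f nicely_meromorphic_on A" and eq: "\<And>z. z \<in> A \<Longrightarrow> h z = to_sphere ?f z"
    using h by (auto simp: mero_map_on_def)
  have some: "h w = Some (?f w)" if "w \<in> A" "?f analytic_on {w}" for w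
    using eq[OF that(1)] analytic_at_imp_no_pole[OF that(2)] by (simp add: to_sphere_def)
  obtain s where s: "s > 0" "ball z s \<subseteq> A" using A open_contains_ball by blast
  show thesis
  proof (cases "is_pole ?f z")
    case False
    then have "?f analytic_on {z}" using nicely_meromorphic_on_imp_analytic_at nm A by blast
    then obtain t where t: "t > 0" "?f holomorphic_on ball z t" by (auto simp: analytic_on_def)
    define r where "r = min s t"
    have r: "r > 0" "ball z r \<subseteq> ball z s" "ball z r \<subseteq> ball z t" using s t by (auto simp: r_def)
    have hol: "?f holomorphic_on ball z r" using t r by (auto intro: holomorphic_on_subset)
    show thesis
    proof (rule finite)
      show "h w = Some (?f w)" if "w \<in> ball z r" for w
        using hol that r s by (intro some) (auto simp: analytic_at)
    qed (use r s hol in auto)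
  next
    case True
    have "isolated_singularity_at ?f z"
      using nm A meromorphic_on_isolated_singularity meromorphic_on_subset
      unfolding nicely_meromorphic_on_def by blast
    then obtain t where t: "t > 0" "?f analytic_on ball z t - {z}"
      by (auto simp: isolated_singularity_at_def)
    obtain d where d: "d > 0" "\<And>w. w \<noteq> z \<Longrightarrow> dist w z < d \<Longrightarrow> ?f w \<noteq> 0"
      using non_zero_neighbour_pole[OF True] by (auto simp: eventually_at)
    define r where "r = min s (min t d)"
    have r: "r > 0" "ball z r \<subseteq> ball z s" "ball z r \<subseteq> ball z t" "ball z r \<subseteq> ball z d"
      using s t d by (auto simp: r_def)
    have an: "?f analytic_on ball z r - {z}" using t r analytic_on_subset by (metis Diff_mono order_refl)
    show thesis
    proof (rule pole)
      show "h z = None" using eq[OF A(2)] True by (simp add: to_sphere_def)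
      show "h w = Some (?f w) \<and> ?f w \<noteq> 0" if w: "w \<in> ball z r - {z}" for w
      proof
        have "?f analytic_on {w}" using an w analytic_on_subset by blast
        then show "h w = Some (?f w)" using w r s by (intro some) auto
        have "w \<in> ball z d" using w r(4) by blast
        then show "?f w \<noteq> 0" using w d by (auto simp: dist_commute)
      qed
    qed (use r s True analytic_imp_holomorphic[OF an] in auto)
  qed
qed

lemma mero_map_on_imp_sph_hol:
  assumes "mero_map_on h A" "open A"
  shows "sph_hol h A"
proof (rule sph_hol_cong[OF _ assms(2)])
  show "sph_hol (to_sphere (finite_part h)) A"
  proof (rule sph_hol_to_sphere)
    fix z assume "z \<in> A"
    then show "\<exists>r>0. finite_part h holomorphic_on ball z r \<or>
        (is_pole (finite_part h) z \<and> finite_part h holomorphic_on ball z r - {z})"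
      by (cases rule: mero_map_on_cases[OF assms]) auto
  qed
  show "to_sphere (finite_part h) z = h z" if "z \<in> A" for z
    using assms that by (auto simp: mero_map_on_def)
qed

lemma is_pole_higher_deriv:
  assumes "f meromorphic_on {z}" "is_pole f z"
  shows "is_pole ((deriv ^^ k) f) z"
  by (induction k) (use assms in \<open>auto simp: is_pole_deriv_iff meromorphic_on_higher_deriv\<close>)

lemma mderiv_at:
  assumes h: "mero_map_on h A" and A: "open A" "z \<in> A"
  shows "mderiv k h z = (if h z = None then None else Some ((deriv ^^ k) (finite_part h) z))"
proof (cases rule: mero_map_on_cases[OF h A])
  case (1 r)
  have "(deriv ^^ k) (finite_part h) holomorphic_on ball z r"
    using 1 by (intro holomorphic_higher_deriv) auto
  then have "\<not> is_pole ((deriv ^^ k) (finite_part h)) z"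
    using 1 not_is_pole_holomorphic[OF open_ball, of z z r] by simp
  then show ?thesis using 1 by (auto simp: mderiv_def to_sphere_def)
next
  case (2 r)
  have "finite_part h meromorphic_on {z}"
    using h A meromorphic_on_subset unfolding mero_map_on_def nicely_meromorphic_on_def by blast
  then show ?thesis using 2 is_pole_higher_deriv by (simp add: mderiv_def to_sphere_def)
qed

lemma sph_hol_mderiv:
  assumes h: "mero_map_on h A" and A: "open A"
  shows "sph_hol (mderiv k h) A"
  unfolding mderiv_def
proof (rule sph_hol_to_sphere)
  fix z assume z: "z \<in> A"
  have mer: "finite_part h meromorphic_on {z}"
    using h z meromorphic_on_subset unfolding mero_map_on_def nicely_meromorphic_on_def by blast
  show "\<exists>r>0. (deriv ^^ k) (finite_part h) holomorphic_on ball z r \<or>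
      (is_pole ((deriv ^^ k) (finite_part h)) z \<and> (deriv ^^ k) (finite_part h) holomorphic_on ball z r - {z})"
  proof (cases rule: mero_map_on_cases[OF h A z])
    case (1 r)
    then show ?thesis using holomorphic_higher_deriv[OF 1(3)] by auto
  next
    case (2 r)
    then show ?thesis using holomorphic_higher_deriv[OF 2(5)] is_pole_higher_deriv[OF mer]
      by (auto simp: open_delete)
  qed
qed

text \<open>
  Unless the function vanishes identically near the point, \<open>zorder\<close> is the index of the first derivative that does not vanish.
\<close>

lemma zero_mult_ge_imp_derivs_zero:
  assumes m: "zero_mult_ge m f z" and f: "f holomorphic_on ball z r" "r > 0" "f z = 0" and "i < m"
  shows "(deriv ^^ i) f z = 0"
  using m unfolding zero_mult_ge_def
proof
  assume "\<forall>\<^sub>F w in at z. f w = 0"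
  then have "\<forall>\<^sub>F w in nhds z. f w = (\<lambda>_. 0) w" using f(3) by (simp add: eventually_nhds_conv_at)
  then have "(deriv ^^ i) f z = (deriv ^^ i) (\<lambda>_. 0) z" by (rule higher_deriv_cong_ev) simp
  then show ?thesis by simp
next
  assume ge: "int m \<le> zorder f z"
  show ?thesis
  proof (rule ccontr)
    assume nz: "(deriv ^^ i) f z \<noteq> 0"
    define j where "j = (LEAST j. (deriv ^^ j) f z \<noteq> 0)"
    have j: "(deriv ^^ j) f z \<noteq> 0" "j \<le> i" unfolding j_def
      using LeastI[of "\<lambda>j. (deriv ^^ j) f z \<noteq> 0", OF nz] Least_le[of "\<lambda>j. (deriv ^^ j) f z \<noteq> 0", OF nz] by auto
    have "zorder f z = int j"
    proof (rule zorder_zero_eqI[OF f(1)])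
      show "(deriv ^^ l) f z = 0" if "l < nat (int j)" for l
        using not_less_Least[of l "\<lambda>j. (deriv ^^ j) f z \<noteq> 0"] that by (auto simp flip: j_def)
    qed (use f j in auto)
    then show False using ge j assms(5) by simp
  qed
qed

lemma holomorphic_taylor_bound:
  assumes f: "f holomorphic_on ball z0 R" and k: "k \<ge> 1"
    and M: "\<And>z. z \<in> ball z0 R \<Longrightarrow> cmod ((deriv ^^ k) f z) \<le> M"
    and w: "w \<in> ball z0 R" and z: "z \<in> ball z0 R"
  shows "cmod (f z - (\<Sum>i<k. (deriv ^^ i) f w * (z - w) ^ i / fact i)) \<le> M * cmod (z - w) ^ k"
proof -
  obtain n where n: "k = Suc n" using k by (cases k) auto
  have "cmod ((\<lambda>i. (deriv ^^ i) f) 0 z - (\<Sum>i\<le>n. (\<lambda>i. (deriv ^^ i) f) i w * (z - w) ^ i / fact i))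
      \<le> M * cmod (z - w) ^ Suc n / fact n"
  proof (rule complex_Taylor[where S = "ball z0 R" and f = "\<lambda>i. (deriv ^^ i) f"])
    show "((deriv ^^ i) f has_field_derivative (deriv ^^ Suc i) f x) (at x within ball z0 R)"
      if "x \<in> ball z0 R" for i x
      using has_field_derivative_higher_deriv[OF f open_ball that] has_field_derivative_at_within by blast
  qed (use M w z n in auto)
  also have "\<dots> \<le> M * cmod (z - w) ^ Suc n / 1"
    using order_trans[OF norm_ge_zero M[OF w]] by (intro divide_left_mono mult_nonneg_nonneg) auto
  finally show ?thesis by (simp add: n lessThan_Suc_atMost)
qed

definition sph_uconv :: "(nat \<Rightarrow> 'a \<Rightarrow> csphere) \<Rightarrow> ('a \<Rightarrow> csphere) \<Rightarrow> 'a set \<Rightarrow> bool" where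
  "sph_uconv s h A \<longleftrightarrow> (\<forall>e>0. \<forall>\<^sub>F n in sequentially. \<forall>q\<in>A. sph_dist (s n q) (h q) < e)"

lemma sph_uconv_Some:
  assumes "uniform_limit A x g sequentially"
  shows "sph_uconv (\<lambda>n z. Some (x n z)) (\<lambda>z. Some (g z)) A"
  unfolding sph_uconv_def
proof (intro allI impI)
  fix e :: real assume "e > 0"
  then obtain \<eta> where \<eta>: "\<eta> > 0"
    "\<And>p q p' q'. \<lbrakk>1 \<le> max (cmod p) (cmod q); 1 \<le> max (cmod p') (cmod q'); cmod (p * q' - p' * q) < \<eta>\<rbrakk>
       \<Longrightarrow> sph_dist (hpoint p q) (hpoint p' q') < e" using sph_dist_less by blast
  have "\<forall>\<^sub>F n in sequentially. \<forall>z\<in>A. dist (x n z) (g z) < \<eta>"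
    using assms \<eta>(1) by (auto simp: uniform_limit_iff)
  then show "\<forall>\<^sub>F n in sequentially. \<forall>z\<in>A. sph_dist (Some (x n z)) (Some (g z)) < e"
    by eventually_elim (use \<eta>(2)[of _ 1 _ 1] in \<open>auto simp: dist_norm\<close>)
qed

lemma sph_uconv_recip:
  assumes "uniform_limit A x g sequentially"
  shows "sph_uconv (\<lambda>n z. recip (x n z)) (\<lambda>z. recip (g z)) A"
  unfolding sph_uconv_def
proof (intro allI impI)
  fix e :: real assume "e > 0"
  then obtain \<eta> where \<eta>: "\<eta> > 0"
    "\<And>p q p' q'. \<lbrakk>1 \<le> max (cmod p) (cmod q); 1 \<le> max (cmod p') (cmod q'); cmod (p * q' - p' * q) < \<eta>\<rbrakk>
       \<Longrightarrow> sph_dist (hpoint p q) (hpoint p' q') < e" using sph_dist_less by blast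
  have "\<forall>\<^sub>F n in sequentially. \<forall>z\<in>A. dist (x n z) (g z) < \<eta>"
    using assms \<eta>(1) by (auto simp: uniform_limit_iff)
  then show "\<forall>\<^sub>F n in sequentially. \<forall>z\<in>A. sph_dist (recip (x n z)) (recip (g z)) < e"
    by eventually_elim (use \<eta>(2)[of 1 _ 1] in \<open>auto simp: dist_norm norm_minus_commute hpoint_recip\<close>)
qed

lemma montel_bounded:
  fixes x :: "nat \<Rightarrow> complex \<Rightarrow> complex"
  assumes "open S" "\<And>n. x n holomorphic_on S" "\<And>n z. z \<in> S \<Longrightarrow> cmod (x n z) \<le> C"
  obtains g r where "g holomorphic_on S" "strict_mono (r :: nat \<Rightarrow> nat)"
    "\<And>K. \<lbrakk>compact K; K \<subseteq> S\<rbrakk> \<Longrightarrow> uniform_limit K (\<lambda>n. x (r n)) g sequentially"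
proof (rule Montel[of S "range x" x])
  show "\<exists>B. \<forall>h\<in>range x. \<forall>z\<in>K. cmod (h z) \<le> B" if "K \<subseteq> S" for K
    using assms(3) that by (intro exI[of _ C]) auto
qed (use assms that in \<open>auto simp: o_def\<close>)

text \<open>
  The Taylor formula at \<open>z0\<close> bounds \<open>x n\<close> on the large disc by its maximum \<open>c n\<close> on the half disc. If \<open>c n\<close>
  stays bounded along a subsequence, Montel's theorem applies to it. Otherwise the functions \<open>x n / c n\<close>
  are bounded; they have no zeros from some index on, because a zero of \<open>x n\<close> together with \<open>mult\<close>
  bounds \<open>c n\<close>. So by Hurwitz's theorem their limit has no zeros either, and \<open>x n\<close> tends to infinity.
\<close>

lemma bounded_derivative_subsequence:
  fixes x :: "nat \<Rightarrow> complex \<Rightarrow> complex"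
  assumes R: "R > 0" and k: "k \<ge> 1" and hol: "\<And>n. x n holomorphic_on ball z0 R"
    and M: "\<And>n z. z \<in> ball z0 R \<Longrightarrow> cmod ((deriv ^^ k) (x n) z) \<le> M"
    and mult: "\<And>n z i. \<lbrakk>z \<in> ball z0 R; x n z = 0; i < k\<rbrakk> \<Longrightarrow> (deriv ^^ i) (x n) z = 0"
  obtains r h where "strict_mono (r :: nat \<Rightarrow> nat)" "sph_hol h (ball z0 (R/2))"
    "sph_uconv (\<lambda>n z. Some (x (r n) z)) h (ball z0 (R/2))"
proof -
  let ?C = "cball z0 (R/2)"
  have C: "compact ?C" "?C \<subseteq> ball z0 R" "?C \<noteq> {}" "ball z0 (R/2) \<subseteq> ?C" using R by auto
  have M0: "M \<ge> 0" using M[of z0 0] R by (auto intro: order_trans[OF norm_ge_zero])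
  have "\<exists>y\<in>?C. \<forall>z\<in>?C. cmod (x n z) \<le> cmod (x n y)" for n
    using C holomorphic_on_imp_continuous_on[OF holomorphic_on_subset[OF hol C(2)]]
    by (intro continuous_attains_sup) (auto intro: continuous_on_norm)
  then obtain y where y: "\<And>n. y n \<in> ?C" "\<And>n z. z \<in> ?C \<Longrightarrow> cmod (x n z) \<le> cmod (x n (y n))"
    by metis
  define c where "c n = cmod (x n (y n))" for n
  have c0: "c n \<ge> 0" for n by (simp add: c_def)
  have bound: "cmod (x n z) \<le> 2 ^ k * c n + M * R ^ k" if z: "z \<in> ball z0 R" for n z
  proof -
    have d: "cmod (z - z0) < R" using z by (simp add: dist_norm norm_minus_commute)
    have "cmod (\<Sum>i<k. (deriv ^^ i) (x n) z0 * (z - z0) ^ i / fact i) \<le> (\<Sum>i<k. 2 ^ i * c n)"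
    proof (rule sum_norm_le)
      fix i
      have "cmod ((deriv ^^ i) (x n) z0) \<le> fact i * c n / (R/2) ^ i"
      proof (rule Cauchy_inequality)
        show "x n holomorphic_on ball z0 (R/2)" "continuous_on ?C (x n)"
          using C by (intro holomorphic_on_imp_continuous_on holomorphic_on_subset[OF hol]; auto)+
        show "cmod (x n w) \<le> c n" if "cmod (z0 - w) = R/2" for w
          unfolding c_def using that y(2)[of w] by (simp add: dist_norm)
      qed (use R in simp)
      then have "cmod ((deriv ^^ i) (x n) z0 * (z - z0) ^ i / fact i) \<le> (fact i * c n / (R/2) ^ i) * R ^ i / fact i"
        unfolding norm_mult norm_divide norm_power norm_fact using d c0[of n] R
        by (intro divide_right_mono mult_mono power_mono) (auto intro!: divide_nonneg_nonneg mult_nonneg_nonneg)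
      also have "\<dots> = 2 ^ i * c n" using R by (simp add: field_simps)
      finally show "cmod ((deriv ^^ i) (x n) z0 * (z - z0) ^ i / fact i) \<le> 2 ^ i * c n" .
    qed
    also have "\<dots> = (2 ^ k - 1) * c n"
      by (simp add: sum_distrib_right[symmetric] lessThan_atLeast0 sum_power2 of_nat_diff flip: of_nat_sum)
         (induction k; simp add: algebra_simps)
    also have "\<dots> \<le> 2 ^ k * c n" using c0 by (intro mult_right_mono) auto
    finally have 1: "cmod (\<Sum>i<k. (deriv ^^ i) (x n) z0 * (z - z0) ^ i / fact i) \<le> 2 ^ k * c n" .
    have "cmod (x n z - (\<Sum>i<k. (deriv ^^ i) (x n) z0 * (z - z0) ^ i / fact i)) \<le> M * cmod (z - z0) ^ k"
      using R by (intro holomorphic_taylor_bound[OF hol k M _ z]) auto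
    also have "\<dots> \<le> M * R ^ k" using d M0 by (intro mult_left_mono power_mono) auto
    finally show ?thesis using 1 norm_triangle_sub[of "x n z"] by (smt (verit))
  qed
  have bound_zero: "c n \<le> M * (2 * R) ^ k" if w: "w \<in> ball z0 R" "x n w = 0" for n w
  proof -
    have yn: "y n \<in> ball z0 R" using y C by blast
    have "cmod (x n (y n) - (\<Sum>i<k. (deriv ^^ i) (x n) w * (y n - w) ^ i / fact i)) \<le> M * cmod (y n - w) ^ k"
      by (rule holomorphic_taylor_bound[OF hol k M w(1) yn])
    moreover have "(\<Sum>i<k. (deriv ^^ i) (x n) w * (y n - w) ^ i / fact i) = 0"
      using mult[OF w] by simp
    moreover have "cmod (y n - w) \<le> 2 * R"
      using w yn dist_triangle2[of "y n" w z0] by (simp add: dist_norm norm_minus_commute)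
    then have "M * cmod (y n - w) ^ k \<le> M * (2 * R) ^ k"
      using M0 by (intro mult_left_mono power_mono) auto
    ultimately show ?thesis by (simp add: c_def)
  qed
  show thesis
  proof (cases "\<exists>B. infinite {n. c n \<le> B}")
    case True
    then obtain B where "infinite {n. c n \<le> B}" by blast
    then obtain r1 :: "nat \<Rightarrow> nat" where r1: "strict_mono r1" "\<And>n. c (r1 n) \<le> B"
      using infinite_enumerate by blast
    have "cmod (x (r1 n) z) \<le> 2 ^ k * B + M * R ^ k" if "z \<in> ball z0 R" for n z
    proof -
      have "2 ^ k * c (r1 n) \<le> 2 ^ k * B" using r1(2) by (intro mult_left_mono) auto
      then show ?thesis using bound[OF that, of "r1 n"] by linarith
    qed
    then obtain g r2 where g: "g holomorphic_on ball z0 R" "strict_mono (r2 :: nat \<Rightarrow> nat)"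
      "\<And>K. \<lbrakk>compact K; K \<subseteq> ball z0 R\<rbrakk> \<Longrightarrow> uniform_limit K (\<lambda>n. x (r1 (r2 n))) g sequentially"
      using montel_bounded[OF open_ball, of "\<lambda>n. x (r1 n)"] hol by metis
    show thesis
    proof (rule that)
      show "strict_mono (\<lambda>n. r1 (r2 n))" using strict_mono_o[OF r1(1) g(2)] by (simp add: o_def)
      have "g holomorphic_on ball z0 (R/2)" using g(1) C by (auto intro: holomorphic_on_subset)
      then show "sph_hol (\<lambda>z. Some (g z)) (ball z0 (R/2))" by (rule sph_hol_Some) simp
      show "sph_uconv (\<lambda>n z. Some (x (r1 (r2 n)) z)) (\<lambda>z. Some (g z)) (ball z0 (R/2))"
        by (rule sph_uconv_Some uniform_limit_on_subset[OF g(3)[OF C(1,2)] C(4)])+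
    qed
  next
    case False
    then have lim: "\<forall>\<^sub>F n in sequentially. B < c n" for B
      by (auto simp: eventually_cofinite not_less simp flip: cofinite_eq_sequentially)
    obtain N where N: "\<And>n. n \<ge> N \<Longrightarrow> max 1 (M * (2 * R) ^ k) < c n"
      using lim by (meson eventually_sequentially)
    define r1 where "r1 n = n + N" for n
    have r1: "strict_mono r1" by (simp add: r1_def strict_mono_def)
    have c1: "1 < c (r1 n)" "M * (2 * R) ^ k < c (r1 n)" for n using N[of "r1 n"] by (auto simp: r1_def)
    define Y where "Y n z = x (r1 n) z / of_real (c (r1 n))" for n z
    have "cmod (Y n z) \<le> 2 ^ k + M * R ^ k" if "z \<in> ball z0 R" for n z
    proof -
      have "cmod (Y n z) = cmod (x (r1 n) z) / c (r1 n)" using c0 by (simp add: Y_def norm_divide)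
      also have "\<dots> \<le> (2 ^ k * c (r1 n) + M * R ^ k) / c (r1 n)"
        using bound[OF that] c0 by (intro divide_right_mono) auto
      also have "\<dots> = 2 ^ k + M * R ^ k / c (r1 n)" using c1[of n] by (simp add: field_simps)
      also have "M * R ^ k / c (r1 n) \<le> M * R ^ k / 1"
        using c1[of n] M0 R by (intro divide_left_mono) auto
      finally show ?thesis by simp
    qed
    moreover have Yhol: "Y n holomorphic_on ball z0 R" for n
      unfolding Y_def using hol c1[of n] by (intro holomorphic_intros) auto
    ultimately obtain g r2 where g: "g holomorphic_on ball z0 R" "strict_mono (r2 :: nat \<Rightarrow> nat)"
      and ul: "\<And>K. \<lbrakk>compact K; K \<subseteq> ball z0 R\<rbrakk> \<Longrightarrow> uniform_limit K (\<lambda>n. Y (r2 n)) g sequentially"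
      using montel_bounded[OF open_ball, of Y] by metis
    have "\<forall>\<^sub>F n in sequentially. \<forall>z\<in>?C. dist (Y (r2 n) z) (g z) < 1"
      using ul[OF C(1,2)] by (auto simp: uniform_limit_iff)
    then obtain n where n: "\<forall>z\<in>?C. dist (Y (r2 n) z) (g z) < 1"
      by (auto simp: eventually_sequentially)
    let ?p = "y (r1 (r2 n))"
    have "cmod (Y (r2 n) ?p) = 1" using c1[of "r2 n"] by (simp add: Y_def norm_divide flip: c_def)
    moreover have "dist (Y (r2 n) ?p) (g ?p) < 1" using n y(1) by blast
    \<comment> \<open>the limit is not identically 0, as all its predecessors attain modulus 1 on a fixed compact set\<close>
    ultimately have gp: "g ?p \<noteq> 0" by auto
    have p: "?p \<in> ball z0 R" using y(1) C by blast
    have g_nz: "g z \<noteq> 0" if z: "z \<in> ball z0 R" for z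
    proof (cases "g constant_on ball z0 R")
      case True
      then show ?thesis using gp z p by (auto simp: constant_on_def)
    next
      case False
      show ?thesis
      proof (rule Hurwitz_no_zeros[OF open_ball _ Yhol g(1) ul False _ z])
        show "Y (r2 m) w \<noteq> 0" if "w \<in> ball z0 R" for m w
          using bound_zero[OF that, of "r1 (r2 m)"] c1[of "r2 m"] by (auto simp: Y_def)
      qed auto
    qed
    have "\<exists>w\<in>?C. \<forall>z\<in>?C. cmod (g w) \<le> cmod (g z)"
      using C holomorphic_on_imp_continuous_on[OF holomorphic_on_subset[OF g(1) C(2)]]
      by (intro continuous_attains_inf) (auto intro: continuous_on_norm)
    then obtain w where w: "w \<in> ?C" "\<And>z. z \<in> ?C \<Longrightarrow> cmod (g w) \<le> cmod (g z)" by blast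
    define m where "m = cmod (g w)"
    have m: "m > 0" using g_nz w C by (auto simp: m_def)
    \<comment> \<open>convergence to infinity, in the chart around infinity\<close>
    have "uniform_limit ?C (\<lambda>n z. inverse (x (r1 (r2 n)) z)) (\<lambda>z. 0) sequentially"
      unfolding uniform_limit_iff
    proof (intro allI impI)
      fix e :: real assume e: "e > 0"
      have "\<forall>\<^sub>F n in sequentially. 2 / (m * e) < c n" by (rule lim)
      from eventually_subseq[OF strict_mono_o[OF r1 g(2)] this]
      have "\<forall>\<^sub>F n in sequentially. 2 / (m * e) < c (r1 (r2 n))" by (simp add: o_def)
      moreover have "\<forall>\<^sub>F n in sequentially. \<forall>z\<in>?C. dist (Y (r2 n) z) (g z) < m / 2"
        using ul[OF C(1,2)] half_gt_zero[OF m] unfolding uniform_limit_iff by blast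
      ultimately show "\<forall>\<^sub>F n in sequentially. \<forall>z\<in>?C. dist (inverse (x (r1 (r2 n)) z)) 0 < e"
      proof eventually_elim
        case (elim n)
        show ?case
        proof
          fix z assume z: "z \<in> ?C"
          let ?c = "c (r1 (r2 n))"
          have "m / 2 < cmod (Y (r2 n) z)"
          proof -
            have "cmod (g z - Y (r2 n) z) < m / 2" using elim(2) z by (simp add: dist_norm norm_minus_commute)
            then show ?thesis using w(2)[OF z] norm_triangle_ineq2[of "g z" "Y (r2 n) z"]
              unfolding m_def by linarith
          qed
          then have "m / 2 * ?c < cmod (x (r1 (r2 n)) z)"
            using c1[of "r2 n"] by (simp add: Y_def norm_divide field_simps)
          moreover have "1 / e < m / 2 * ?c" using elim(1) m e by (simp add: field_simps)
          ultimately have "1 / e < cmod (x (r1 (r2 n)) z)" by simp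
          then have "inverse (cmod (x (r1 (r2 n)) z)) < inverse (1 / e)"
            using e by (intro less_imp_inverse_less) auto
          then show "dist (inverse (x (r1 (r2 n)) z)) 0 < e" using e by (simp add: norm_inverse)
        qed
      qed
    qed
    then have "sph_uconv (\<lambda>n z. recip (inverse (x (r1 (r2 n)) z))) (\<lambda>z. recip 0) (ball z0 (R/2))"
      by (intro sph_uconv_recip uniform_limit_on_subset[OF _ C(4)])
    moreover have "recip (inverse (x (r1 (r2 n)) z)) = Some (x (r1 (r2 n)) z)" if "z \<in> ball z0 (R/2)" for n z
    proof -
      have "z \<in> ball z0 R" using that C by blast
      then have "x (r1 (r2 n)) z \<noteq> 0" using bound_zero c1[of "r2 n"] by (meson not_less)
      then show ?thesis by (simp add: recip_def field_simps)
    qed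
    ultimately have "sph_uconv (\<lambda>n z. Some (x (r1 (r2 n)) z)) (\<lambda>z. recip 0) (ball z0 (R/2))"
      by (simp add: sph_uconv_def)
    moreover have "sph_hol (\<lambda>z. recip 0) (ball z0 (R/2))" by (rule sph_hol_recip) auto
    ultimately show thesis
      using strict_mono_o[OF r1 g(2)] by (intro that) (auto simp: o_def)
  qed
qed

section \<open>A large derivative, and normality near a point\<close>

text \<open>
  Let \<open>z1\<close> maximise the weighted modulus \<open>(R' - |z - z0|)^k |v z|\<close>, and let \<open>d = R' - |z1 - z0|\<close>. On the
  disc of radius \<open>d/2\<close> around \<open>z1\<close> the weight drops by a factor of at most \<open>2^k\<close>, so \<open>|v| \<le> 2^k |v z1|\<close>
  there. Therefore \<open>v\<close> hardly changes on the disc of radius \<open>t = d / (24 2^k)\<close>, where \<open>|1/v| \<le> 2/|v z1|\<close>,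
  and Cauchy's inequality bounds the \<open>k\<close>-th derivative of \<open>1/v\<close> at \<open>z1\<close> by \<open>2 k! / (|v z1| t^k)\<close>. As this
  derivative has modulus at least \<open>1/B\<close>, the maximum \<open>|v z1| d^k\<close> is bounded.
\<close>

lemma reciprocal_bound:
  assumes R: "R > 0" and k: "k \<ge> 1" and B: "B \<ge> 0" and v: "v holomorphic_on ball z0 R"
    and large: "\<And>z. z \<in> ball z0 R \<Longrightarrow> v z \<noteq> 0 \<Longrightarrow> 1 \<le> B * cmod ((deriv ^^ k) (\<lambda>w. inverse (v w)) z)"
    and z: "z \<in> ball z0 (R/3)"
  shows "cmod (v z) \<le> 2 * B * fact k * (24 * 2 ^ k) ^ k / (R/3) ^ k"
proof -
  define R' where "R' = 2 * R / 3"
  define W where "W z = (R' - cmod (z - z0)) ^ k * cmod (v z)" for z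
  have sub: "cball z0 R' \<subseteq> ball z0 R" using R by (auto simp: R'_def)
  have "\<exists>x\<in>cball z0 R'. \<forall>y\<in>cball z0 R'. W y \<le> W x"
    unfolding W_def using R
    by (intro continuous_attains_sup continuous_intros holomorphic_on_imp_continuous_on holomorphic_on_subset[OF v sub])
       (auto simp: R'_def)
  then obtain z1 where z1: "z1 \<in> cball z0 R'" and max: "\<And>y. y \<in> cball z0 R' \<Longrightarrow> W y \<le> W z1" by blast
  define d where "d = R' - cmod (z1 - z0)"
  have d0: "d \<ge> 0" using z1 by (simp add: d_def dist_norm norm_minus_commute)
  define T :: real where "T = 24 * 2 ^ k"
  have T: "T \<ge> 24" by (simp add: T_def)
  have "W z1 \<le> 2 * B * fact k * T ^ k"
  proof (cases "v z1 = 0 \<or> d = 0")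
    case True
    then have "W z1 = 0" using k by (auto simp: W_def d_def)
    then show ?thesis using B T by simp
  next
    case False
    then have d: "d > 0" and vz1: "cmod (v z1) > 0" using d0 by auto
    define K where "K = 2 ^ k * cmod (v z1)"
    have K: "K > 0" using vz1 by (simp add: K_def)
    have inR': "w \<in> cball z0 R' \<and> d / 2 \<le> R' - cmod (w - z0)" if "w \<in> ball z1 (d/2)" for w
      using that norm_triangle_ineq[of "w - z1" "z1 - z0"] d
      by (simp add: d_def dist_norm norm_minus_commute field_simps)
    then have sub1: "ball z1 (d/2) \<subseteq> ball z0 R" using sub by blast
    have vK: "cmod (v w) \<le> K" if w: "w \<in> ball z1 (d/2)" for w
    proof -
      have "(d/2) ^ k * cmod (v w) \<le> W w"
        unfolding W_def using inR'[OF w] d by (intro mult_right_mono power_mono) auto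
      also have "\<dots> \<le> W z1" using max inR'[OF w] by blast
      also have "\<dots> = (d/2) ^ k * K" by (simp add: W_def K_def d_def[symmetric] power_divide)
      finally show ?thesis using d by simp
    qed
    define t where "t = d / T"
    have t: "t > 0" "t < d / 2" using d T by (auto simp: t_def divide_simps)
    have half: "cmod (v z1) / 2 \<le> cmod (v w)" if w: "w \<in> cball z1 t" for w
    proof -
      have "cmod (v w - v z1) \<le> 3 * K / (d/2) * cmod (w - z1)"
        using w t d vK by (intro bounded_holomorphic_near_center[OF holomorphic_on_subset[OF v sub1] _ K]) auto
      also have "\<dots> \<le> 3 * K / (d/2) * t"
        using w K d by (intro mult_left_mono) (auto simp: dist_norm norm_minus_commute)
      also have "\<dots> = cmod (v z1) / 4" using d by (simp add: K_def t_def T_def)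
      finally have "cmod (v w - v z1) \<le> cmod (v z1) / 4" .
      then show ?thesis using norm_triangle_ineq2[of "v z1" "v w"] vz1 unfolding norm_minus_commute[of "v z1" "v w"] by linarith
    qed
    have nz: "v w \<noteq> 0" if "w \<in> cball z1 t" for w using half[OF that] vz1 by auto
    have sub2: "cball z1 t \<subseteq> ball z0 R" using sub1 t by auto
    have inv: "(\<lambda>w. inverse (v w)) holomorphic_on cball z1 t"
      using nz by (intro holomorphic_intros holomorphic_on_subset[OF v sub2]) auto
    have "cmod ((deriv ^^ k) (\<lambda>w. inverse (v w)) z1) \<le> fact k * (2 / cmod (v z1)) / t ^ k"
    proof (rule Cauchy_inequality)
      show "(\<lambda>w. inverse (v w)) holomorphic_on ball z1 t"
        by (rule holomorphic_on_subset[OF inv]) auto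
      show "continuous_on (cball z1 t) (\<lambda>w. inverse (v w))"
        by (rule holomorphic_on_imp_continuous_on[OF inv])
      fix w assume "cmod (z1 - w) = t"
      then have "cmod (v z1) / 2 \<le> cmod (v w)" using half by (simp add: dist_norm)
      then have "inverse (cmod (v w)) \<le> inverse (cmod (v z1) / 2)"
        using vz1 by (intro le_imp_inverse_le) auto
      then show "cmod (inverse (v w)) \<le> 2 / cmod (v z1)" by (simp add: norm_inverse)
    qed (use t in simp)
    then have "B * cmod ((deriv ^^ k) (\<lambda>w. inverse (v w)) z1) \<le> B * (fact k * (2 / cmod (v z1)) / t ^ k)"
      using B by (intro mult_left_mono)
    moreover have "1 \<le> B * cmod ((deriv ^^ k) (\<lambda>w. inverse (v w)) z1)"
      using large[of z1] vz1 z1 sub by auto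
    ultimately have "1 \<le> B * (fact k * (2 / cmod (v z1)) / t ^ k)" by linarith
    then have "cmod (v z1) * t ^ k \<le> 2 * B * fact k"
      using t vz1 by (simp add: field_simps)
    then have "(cmod (v z1) * t ^ k) * T ^ k \<le> 2 * B * fact k * T ^ k"
      using T by (intro mult_right_mono) auto
    moreover have "W z1 = (cmod (v z1) * t ^ k) * T ^ k"
      using T by (simp add: W_def t_def power_divide flip: d_def)
    ultimately show ?thesis by simp
  qed
  moreover have "(R/3) ^ k * cmod (v z) \<le> W z"
    unfolding W_def R'_def using z R
    by (intro mult_right_mono power_mono) (auto simp: dist_norm norm_minus_commute)
  moreover have "W z \<le> W z1" using z R by (intro max) (auto simp: R'_def)
  ultimately have "(R/3) ^ k * cmod (v z) \<le> 2 * B * fact k * T ^ k" by linarith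
  then show ?thesis using R by (simp add: T_def pos_le_divide_eq mult.commute[of "cmod (v z)"])
qed

text \<open>
  This is the identity theorem for the determinant of the coordinates of \<open>F\<close> and \<open>G\<close>.
\<close>

lemma sph_hol_coincidence:
  assumes "sph_hol F A" "sph_hol G A" "z0 \<in> A"
  obtains s where "s > 0" "(\<forall>z\<in>ball z0 s. F z = G z) \<or> (\<forall>z\<in>ball z0 s - {z0}. F z \<noteq> G z)"
proof -
  obtain r1 P1 Q1 where 1: "r1 > 0" "P1 holomorphic_on ball z0 r1" "Q1 holomorphic_on ball z0 r1"
    "\<And>w. w \<in> ball z0 r1 \<Longrightarrow> P1 w \<noteq> 0 \<or> Q1 w \<noteq> 0" "\<And>w. w \<in> ball z0 r1 \<Longrightarrow> F w = hpoint (P1 w) (Q1 w)"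
    using sph_holE[OF assms(1,3)] by blast
  obtain r2 P2 Q2 where 2: "r2 > 0" "P2 holomorphic_on ball z0 r2" "Q2 holomorphic_on ball z0 r2"
    "\<And>w. w \<in> ball z0 r2 \<Longrightarrow> P2 w \<noteq> 0 \<or> Q2 w \<noteq> 0" "\<And>w. w \<in> ball z0 r2 \<Longrightarrow> G w = hpoint (P2 w) (Q2 w)"
    using sph_holE[OF assms(2,3)] by blast
  define r where "r = min r1 r2"
  have r: "r > 0" "ball z0 r \<subseteq> ball z0 r1" "ball z0 r \<subseteq> ball z0 r2" using 1 2 by (auto simp: r_def)
  define D where "D w = P1 w * Q2 w - P2 w * Q1 w" for w
  have D: "F w = G w \<longleftrightarrow> D w = 0" if "w \<in> ball z0 r" for w
  proof -
    have "w \<in> ball z0 r1" "w \<in> ball z0 r2" using that r by blast+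
    then show ?thesis using 1(4,5) 2(4,5) hpoint_eq_iff by (simp add: D_def)
  qed
  have "D holomorphic_on ball z0 r"
    unfolding D_def[abs_def]
    by (intro holomorphic_intros 1(2,3)[THEN holomorphic_on_subset] 2(2,3)[THEN holomorphic_on_subset] r)
  then have an: "D analytic_on {z0}" using r(1) analytic_at by fastforce
  show thesis
  proof (cases "\<exists>\<^sub>F w in at z0. D w = 0")
    case True
    then have ev: "\<forall>\<^sub>F w in at z0. D w = 0"
      using an not_essential_frequently_0_imp_eventually_0 isolated_singularity_at_analytic not_essential_analytic
      by blast
    have "D \<midarrow>z0\<rightarrow> D z0" using an analytic_at_imp_isCont isCont_def by blast
    moreover have "D \<midarrow>z0\<rightarrow> 0" using ev by (simp add: tendsto_eventually)
    ultimately have "D z0 = 0" using LIM_unique by blast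
    then have "\<forall>\<^sub>F w in nhds z0. D w = 0" using ev eventually_nhds_conv_at by blast
    then obtain d where "d > 0" "\<And>w. dist w z0 < d \<Longrightarrow> D w = 0" by (auto simp: eventually_nhds_metric)
    then show thesis using r(1) D
      by (intro that[of "min r d"]) (auto simp: dist_commute)
  next
    case False
    then have "\<forall>\<^sub>F w in at z0. D w \<noteq> 0" by (simp add: frequently_def)
    then obtain d where "d > 0" "\<And>w. w \<noteq> z0 \<Longrightarrow> dist w z0 < d \<Longrightarrow> D w \<noteq> 0" by (auto simp: eventually_at)
    then show thesis using r(1) D
      by (intro that[of "min r d"]) (auto simp: dist_commute)
  qed
qed

lemma sph_dist_self: "sph_dist p p = 0"
  using norm_stereo[of p] by (simp add: sph_dist_def norm_eq_sqrt_inner)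

text \<open>
  The theorem in the neighbourhood of a point, in a chart. One disc serves all members of the sequence
  because \<open>share\<close> reduces the coincidence sets to those of \<open>f 0\<close>.
\<close>

lemma planar_normality:
  fixes f :: "nat \<Rightarrow> complex \<Rightarrow> csphere" and a :: "nat \<Rightarrow> nat \<Rightarrow> complex \<Rightarrow> csphere"
  assumes R: "R > 0" and \<epsilon>: "\<epsilon> > 0" and k: "k \<ge> 1"
    and mero: "\<And>n. mero_map_on (f n) (ball z0 R)"
    and zeros: "\<And>n z. \<lbrakk>z \<in> ball z0 R; f n z = Some 0\<rbrakk> \<Longrightarrow> zero_mult_ge (k + 1) (finite_part (f n)) z"
    and a: "\<And>n j. j \<in> {1,2,3} \<Longrightarrow> sph_hol (a j n) (ball z0 R)"
    and sep: "\<And>n j l z. \<lbrakk>j \<in> {1,2,3}; l \<in> {1,2,3}; j \<noteq> l; z \<in> ball z0 R\<rbrakk> \<Longrightarrow> \<epsilon> \<le> sph_dist (a j n z) (a l n z)"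
    and share: "\<And>n m j z. \<lbrakk>j \<in> {1,2,3}; z \<in> ball z0 R\<rbrakk> \<Longrightarrow>
        mderiv k (f n) z = a j n z \<longleftrightarrow> mderiv k (f m) z = a j m z"
  obtains r h \<rho> where "strict_mono (r :: nat \<Rightarrow> nat)" "\<rho> > 0" "\<rho> \<le> R" "sph_hol h (ball z0 \<rho>)"
    "sph_uconv (\<lambda>n. f (r n)) h (ball z0 \<rho>)"
proof -
  define F where "F n = mderiv k (f n)" for n
  have F: "sph_hol (F n) (ball z0 R)" for n
    unfolding F_def by (rule sph_hol_mderiv[OF mero open_ball])
  have z0: "z0 \<in> ball z0 R" using R by simp
  have "\<exists>s>0. (\<forall>z\<in>ball z0 s. F 0 z = a j 0 z) \<or> (\<forall>z\<in>ball z0 s - {z0}. F 0 z \<noteq> a j 0 z)"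
    if "j \<in> {1,2,3}" for j
    using sph_hol_coincidence[OF F a[OF that] z0] by metis
  then obtain s where s: "\<And>j. j \<in> {1,2,3} \<Longrightarrow> s j > 0 \<and>
      ((\<forall>z\<in>ball z0 (s j). F 0 z = a j 0 z) \<or> (\<forall>z\<in>ball z0 (s j) - {z0}. F 0 z \<noteq> a j 0 z))"
    by metis
  define R1 where "R1 = min R (min (s 1) (min (s 2) (s 3)))"
  have R1: "R1 > 0" "ball z0 R1 \<subseteq> ball z0 R" "R1 \<le> R"
    using R s[of 1] s[of 2] s[of 3] by (auto simp: R1_def)
  have subs: "ball z0 R1 \<subseteq> ball z0 (s j)" if "j \<in> {1,2,3}" for j using that by (auto simp: R1_def)
  have alt: "(\<forall>z\<in>ball z0 R1. F n z = a j n z) \<or> (\<forall>z\<in>ball z0 R1 - {z0}. F n z \<noteq> a j n z)"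
    if j: "j \<in> {1,2,3}" for j n
  proof -
    have "F n z = a j n z \<longleftrightarrow> F 0 z = a j 0 z" if "z \<in> ball z0 R1" for z
      using share[OF j, of z n 0] that R1(2) by (auto simp: F_def)
    then show ?thesis using s[OF j] subs[OF j] by blast
  qed
  \<comment> \<open>the separated functions cannot take the same value at \<open>z0\<close>\<close>
  have once: "\<not> (F 0 z0 = a j 0 z0 \<and> F 0 z0 = a l 0 z0)"
    if "j \<in> {1,2,3}" "l \<in> {1,2,3}" "j \<noteq> l" for j l
    using sep[OF that z0, of 0] \<epsilon> by (auto simp: sph_dist_self)
  \<comment> \<open>\<open>j1\<close> is the index of the function that \<open>F\<close> may meet at \<open>z0\<close>\<close>
  obtain j1 j2 j3 where j: "j1 \<in> {1,2,3::nat}" "j2 \<in> {1,2,3::nat}" "j3 \<in> {1,2,3::nat}"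
      "j1 \<noteq> j2" "j2 \<noteq> j3" "j3 \<noteq> j1" and nz: "F 0 z0 \<noteq> a j2 0 z0" "F 0 z0 \<noteq> a j3 0 z0"
  proof -
    have "\<not> (F 0 z0 = a 1 0 z0 \<and> F 0 z0 = a 2 0 z0)" "\<not> (F 0 z0 = a 2 0 z0 \<and> F 0 z0 = a 3 0 z0)"
      "\<not> (F 0 z0 = a 1 0 z0 \<and> F 0 z0 = a 3 0 z0)" by (rule once; simp)+
    then consider "F 0 z0 \<noteq> a 2 0 z0" "F 0 z0 \<noteq> a 3 0 z0" | "F 0 z0 \<noteq> a 1 0 z0" "F 0 z0 \<noteq> a 3 0 z0"
      | "F 0 z0 \<noteq> a 1 0 z0" "F 0 z0 \<noteq> a 2 0 z0" by blast
    then show thesis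
    proof cases
      case 1
      then show ?thesis by (intro that[of 1 2 3]) simp_all
    next
      case 2
      then show ?thesis by (intro that[of 2 1 3]) simp_all
    next
      case 3
      then show ?thesis by (intro that[of 3 1 2]) simp_all
    qed
  qed
  have omit: "F n z \<noteq> a j n z"
    if j: "j \<in> {1,2,3}" and "F 0 z0 \<noteq> a j 0 z0" and z: "z \<in> ball z0 R1" for n j z
  proof -
    have "F n z0 \<noteq> a j n z0" using share[OF j z0, of n 0] that by (auto simp: F_def)
    then show ?thesis using alt[OF j, of n] z R1(1) by (metis DiffI centre_in_ball singletonD)
  qed
  obtain \<rho> M where \<rho>: "\<rho> > 0" "\<rho> \<le> R1" and M: "M > 0" and omits_three:
    "\<And>F a b c z0. \<lbrakk>sph_hol F (ball z0 R1); sph_hol a (ball z0 R1); sph_hol b (ball z0 R1); sph_hol c (ball z0 R1);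
        \<And>z. z \<in> ball z0 R1 \<Longrightarrow> \<epsilon> \<le> sph_dist (a z) (b z);
        \<And>z. z \<in> ball z0 R1 \<Longrightarrow> \<epsilon> \<le> sph_dist (b z) (c z);
        \<And>z. z \<in> ball z0 R1 \<Longrightarrow> \<epsilon> \<le> sph_dist (c z) (a z);
        \<And>z. z \<in> ball z0 R1 \<Longrightarrow> F z \<noteq> b z; \<And>z. z \<in> ball z0 R1 \<Longrightarrow> F z \<noteq> c z;
        (\<forall>z\<in>ball z0 R1. F z = a z) \<or> (\<forall>z\<in>ball z0 R1 - {z0}. F z \<noteq> a z)\<rbrakk>
      \<Longrightarrow> chart_bounded M F (ball z0 \<rho>)"
    using omits_three_imp_chart_bounded[OF \<epsilon> R1(1)] by blast
  have cb: "chart_bounded M (F n) (ball z0 \<rho>)" for n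
  proof (rule omits_three[where a = "a j1 n" and b = "a j2 n" and c = "a j3 n"])
    show "sph_hol (F n) (ball z0 R1)" by (rule sph_hol_subset[OF F R1(2)])
    show "sph_hol (a j1 n) (ball z0 R1)" "sph_hol (a j2 n) (ball z0 R1)" "sph_hol (a j3 n) (ball z0 R1)"
      by (rule sph_hol_subset[OF a R1(2)]; fact j)+
    fix z assume z: "z \<in> ball z0 R1"
    then have z': "z \<in> ball z0 R" using R1(2) by blast
    show "\<epsilon> \<le> sph_dist (a j1 n z) (a j2 n z)" by (rule sep[OF j(1,2,4) z'])
    show "\<epsilon> \<le> sph_dist (a j2 n z) (a j3 n z)" by (rule sep[OF j(2,3,5) z'])
    show "\<epsilon> \<le> sph_dist (a j3 n z) (a j1 n z)" by (rule sep[OF j(3,1,6) z'])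
    show "F n z \<noteq> a j2 n z" by (rule omit[OF j(2) nz(1) z])
    show "F n z \<noteq> a j3 n z" by (rule omit[OF j(3) nz(2) z])
  qed (rule alt[OF j(1)])
  have \<rho>R: "ball z0 \<rho> \<subseteq> ball z0 R" using \<rho> R1 by auto
  have mero': "mero_map_on (f n) (ball z0 \<rho>)" for n
    using mero[of n] \<rho>R nicely_meromorphic_on_subset unfolding mero_map_on_def by blast
  have Fz: "F n z = (if f n z = None then None else Some ((deriv ^^ k) (finite_part (f n)) z))"
    if "z \<in> ball z0 \<rho>" for n z
    unfolding F_def by (rule mderiv_at[OF mero' open_ball that])
  define small where "small n \<longleftrightarrow> (\<exists>g. (\<forall>z\<in>ball z0 \<rho>. cmod (g z) \<le> M \<and> F n z = Some (g z)))" for n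
  define large where "large n \<longleftrightarrow> (\<exists>g. (\<forall>z\<in>ball z0 \<rho>. cmod (g z) \<le> M \<and> F n z = recip (g z)))" for n
  have "small n \<or> large n" for n
    using cb[of n] unfolding chart_bounded_def small_def large_def by blast
  then have "{n. small n} \<union> {n. large n} = UNIV" by auto
  then have "infinite {n. small n} \<or> infinite {n. large n}"
    using infinite_UNIV_nat finite_UnI by metis
  then show thesis
  proof
    assume "infinite {n. small n}"
    then obtain r1 :: "nat \<Rightarrow> nat" where r1: "strict_mono r1" "\<And>n. small (r1 n)"
      using infinite_enumerate by blast
    define x where "x n = finite_part (f (r1 n))" for n
    have fin: "f (r1 n) z \<noteq> None" "cmod ((deriv ^^ k) (x n) z) \<le> M" if "z \<in> ball z0 \<rho>" for n z
    proof -
      obtain g where "\<forall>z\<in>ball z0 \<rho>. cmod (g z) \<le> M \<and> F (r1 n) z = Some (g z)"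
        using r1(2)[of n] unfolding small_def by (elim exE)
      from bspec[OF this that] have "cmod (g z) \<le> M" "F (r1 n) z = Some (g z)" by simp_all
      then show "f (r1 n) z \<noteq> None" "cmod ((deriv ^^ k) (x n) z) \<le> M"
        using Fz[OF that, of "r1 n"] by (auto simp: x_def split: if_splits)
    qed
    have fx: "f (r1 n) z = Some (x n z)" if "z \<in> ball z0 \<rho>" for n z
      using fin(1)[OF that, of n] by (auto simp: x_def finite_part_def)
    have x_loc: "\<exists>s>0. x n holomorphic_on ball z s" if "z \<in> ball z0 \<rho>" for n z
      unfolding x_def by (cases rule: mero_map_on_cases[OF mero' open_ball that, of "r1 n"]) (use fin(1)[OF that, of n] in auto)
    have x_hol: "x n holomorphic_on ball z0 \<rho>" for n
      using x_loc by (meson analytic_imp_holomorphic analytic_on_def)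
    have x_mult: "(deriv ^^ i) (x n) z = 0" if "z \<in> ball z0 \<rho>" "x n z = 0" "i < k" for n z i
    proof -
      have "zero_mult_ge (k + 1) (x n) z"
        unfolding x_def using that fx[OF that(1), of n] \<rho>R by (intro zeros) auto
      then show ?thesis using x_loc[OF that(1), of n] that(2,3) zero_mult_ge_imp_derivs_zero[of "k+1" "x n" z _ i] by auto
    qed
    obtain r2 h where r2: "strict_mono (r2 :: nat \<Rightarrow> nat)" "sph_hol h (ball z0 (\<rho>/2))"
      "sph_uconv (\<lambda>n z. Some (x (r2 n) z)) h (ball z0 (\<rho>/2))"
      by (rule bounded_derivative_subsequence[of \<rho> k x z0 M, OF \<rho>(1) k x_hol fin(2) x_mult])
    show thesis
    proof (rule that)
      show "strict_mono (\<lambda>n. r1 (r2 n))" using strict_mono_o[OF r1(1) r2(1)] by (simp add: o_def)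
      show "sph_uconv (\<lambda>n. f (r1 (r2 n))) h (ball z0 (\<rho>/2))"
        using r2(3) fx \<rho> unfolding sph_uconv_def by simp
    qed (use r2 \<rho> R1 in auto)
  next
    assume "infinite {n. large n}"
    then obtain r1 :: "nat \<Rightarrow> nat" where r1: "strict_mono r1" "\<And>n. large (r1 n)"
      using infinite_enumerate by blast
    define v where "v n z = inverse (finite_part (f (r1 n)) z)" for n z
    have big: "F (r1 n) z \<noteq> Some 0" "f (r1 n) z \<noteq> None \<Longrightarrow> 1 \<le> M * cmod ((deriv ^^ k) (finite_part (f (r1 n))) z)"
      if "z \<in> ball z0 \<rho>" for n z
    proof -
      obtain g where "\<forall>z\<in>ball z0 \<rho>. cmod (g z) \<le> M \<and> F (r1 n) z = recip (g z)"
        using r1(2)[of n] unfolding large_def by (elim exE)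
      from bspec[OF this that] obtain w where w: "cmod w \<le> M" "F (r1 n) z = recip w" by blast
      then show "F (r1 n) z \<noteq> Some 0" by (simp add: recip_def)
      assume "f (r1 n) z \<noteq> None"
      then have "w \<noteq> 0" "(deriv ^^ k) (finite_part (f (r1 n))) z = 1 / w"
        using w Fz[OF that, of "r1 n"] by (auto simp: recip_def split: if_splits)
      then show "1 \<le> M * cmod ((deriv ^^ k) (finite_part (f (r1 n))) z)"
        using w by (simp add: norm_divide)
    qed
    have f_nz: "f (r1 n) z \<noteq> Some 0" if z: "z \<in> ball z0 \<rho>" for n z
    proof
      assume f0: "f (r1 n) z = Some 0"
      then have m: "zero_mult_ge (k + 1) (finite_part (f (r1 n))) z" using z \<rho>R by (intro zeros) auto
      have "(deriv ^^ k) (finite_part (f (r1 n))) z = 0"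
      proof (cases rule: mero_map_on_cases[OF mero' open_ball z, of "r1 n"])
        case (1 r)
        then show ?thesis using f0 by (intro zero_mult_ge_imp_derivs_zero[OF m 1(3)]) (auto simp: finite_part_def)
      qed (use f0 in auto)
      then show False using big(1)[OF z, of n] Fz[OF z, of "r1 n"] f0 by simp
    qed
    have v_eq: "f (r1 n) z = recip (v n z)" if "z \<in> ball z0 \<rho>" for n z
      using f_nz[OF that, of n] by (cases "f (r1 n) z") (auto simp: v_def recip_def finite_part_def field_simps)
    have v_loc: "\<exists>s>0. v n holomorphic_on ball z s" if z: "z \<in> ball z0 \<rho>" for n z
    proof (cases rule: mero_map_on_cases[OF mero' open_ball z, of "r1 n"])
      case (1 r)
      have "finite_part (f (r1 n)) w \<noteq> 0" if "w \<in> ball z r" for w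
        using f_nz[of w n] 1(2) 1(4)[OF that] that by auto
      then have "v n holomorphic_on ball z r" unfolding v_def using 1 by (intro holomorphic_intros) auto
      then show ?thesis using 1 by blast
    next
      case (2 r)
      have "(\<lambda>x. if x = z then 0 else inverse (finite_part (f (r1 n)) x)) holomorphic_on ball z r"
        using 2 by (intro is_pole_inverse_holomorphic) auto
      moreover have "(\<lambda>x. if x = z then 0 else inverse (finite_part (f (r1 n)) x)) = v n"
        using 2(4) by (auto simp: v_def fun_eq_iff finite_part_def)
      ultimately show ?thesis using 2(1) by auto
    qed
    have v_hol: "v n holomorphic_on ball z0 \<rho>" for n
      using v_loc by (meson analytic_imp_holomorphic analytic_on_def)
    have v_bd: "cmod (v n z) \<le> 2 * M * fact k * (24 * 2 ^ k) ^ k / (\<rho>/3) ^ k" if "z \<in> ball z0 (\<rho>/3)" for n z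
    proof (rule reciprocal_bound[OF \<rho>(1) k _ v_hol _ that])
      show "1 \<le> M * cmod ((deriv ^^ k) (\<lambda>w. inverse (v n w)) z)" if "z \<in> ball z0 \<rho>" "v n z \<noteq> 0" for z
      proof -
        have "f (r1 n) z \<noteq> None" using v_eq[OF that(1), of n] that(2) by (simp add: recip_def)
        then show ?thesis using big(2)[OF that(1), of n] by (simp add: v_def[abs_def])
      qed
    qed (use M in auto)
    have sub: "ball z0 (\<rho>/3) \<subseteq> ball z0 \<rho>" "cball z0 (\<rho>/6) \<subseteq> ball z0 (\<rho>/3)" "ball z0 (\<rho>/6) \<subseteq> cball z0 (\<rho>/6)"
      using \<rho> by auto
    obtain g r2 where g: "g holomorphic_on ball z0 (\<rho>/3)" "strict_mono (r2 :: nat \<Rightarrow> nat)"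
      "\<And>K. \<lbrakk>compact K; K \<subseteq> ball z0 (\<rho>/3)\<rbrakk> \<Longrightarrow> uniform_limit K (\<lambda>n. v (r2 n)) g sequentially"
      using montel_bounded[of "ball z0 (\<rho>/3)" v, OF open_ball holomorphic_on_subset[OF v_hol sub(1)] v_bd] by metis
    show thesis
    proof (rule that)
      show "strict_mono (\<lambda>n. r1 (r2 n))" using strict_mono_o[OF r1(1) g(2)] by (simp add: o_def)
      have "g holomorphic_on ball z0 (\<rho>/6)" using sub g(1) by (meson holomorphic_on_subset order_trans)
      then show "sph_hol (\<lambda>z. recip (g z)) (ball z0 (\<rho>/6))" by (rule sph_hol_recip) simp
      have "sph_uconv (\<lambda>n z. recip (v (r2 n) z)) (\<lambda>z. recip (g z)) (ball z0 (\<rho>/6))"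
        by (rule sph_uconv_recip uniform_limit_on_subset[OF g(3)[OF compact_cball sub(2)] sub(3)])+
      then show "sph_uconv (\<lambda>n. f (r1 (r2 n))) (\<lambda>z. recip (g z)) (ball z0 (\<rho>/6))"
        using v_eq \<rho> unfolding sph_uconv_def by simp
    qed (use \<rho> R1 in auto)
  qed
qed

section \<open>From local to global convergence\<close>

lemma open_reciprocal_preimage: "open U \<Longrightarrow> open {w. w \<noteq> 0 \<and> 1 / w \<in> U}" for U :: "complex set"
proof -
  assume "open U"
  moreover have "continuous_on (- {0}) (\<lambda>w::complex. 1 / w)" by (intro continuous_intros) auto
  ultimately have "open (- {0} \<inter> (\<lambda>w::complex. 1 / w) -` U)"
    by (intro continuous_open_preimage) auto
  moreover have "- {0} \<inter> (\<lambda>w::complex. 1 / w) -` U = {w. w \<noteq> 0 \<and> 1 / w \<in> U}" by auto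
  ultimately show ?thesis by simp
qed

lemma openin_chart_image:
  assumes \<phi>: "\<phi> \<in> sphere_charts" and U: "open U"
  shows "openin sphere_top (\<phi> ` U)"
proof -
  define W where "W = {w. w \<noteq> 0 \<and> 1 / w \<in> U}"
  have W: "open W" unfolding W_def by (rule open_reciprocal_preimage[OF U])
  have S: "recip ` (U - {0}) = Some ` W"
  proof (intro equalityI subsetI)
    fix p assume "p \<in> recip ` (U - {0})"
    then obtain w where "w \<in> U" "w \<noteq> 0" "p = Some (1 / w)" by (auto simp: recip_def)
    then show "p \<in> Some ` W" by (auto simp: W_def intro!: image_eqI[of _ _ "1 / w"])
  next
    fix p assume "p \<in> Some ` W"
    then obtain w where "1 / w \<in> U" "w \<noteq> 0" "p = Some w" by (auto simp: W_def)
    then show "p \<in> recip ` (U - {0})" by (auto simp: recip_def intro!: image_eqI[of _ _ "1 / w"])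
  qed
  consider "\<phi> = Some" | "\<phi> = recip" "0 \<notin> U" | "\<phi> = recip" "0 \<in> U" using \<phi> by blast
  then show ?thesis
  proof cases
    case 1
    then show ?thesis using U by simp
  next
    case 2
    then have "\<phi> ` U = Some ` W" using S by simp
    then show ?thesis using W by simp
  next
    case 3
    obtain e where e: "e > 0" "ball 0 e \<subseteq> U" using U 3 open_contains_ball by blast
    have "\<phi> ` U = insert (recip 0) (recip ` (U - {0}))" using 3 by auto
    then have eq: "\<phi> ` U = insert None (Some ` (topspace euclidean - (- W)))"
      unfolding S by (simp add: recip_def)
    have "- W \<subseteq> cball 0 (1 / e)"
    proof
      fix w assume w: "w \<in> - W"
      have "cmod w \<le> 1 / e"
      proof (rule ccontr)
        assume "\<not> cmod w \<le> 1 / e"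
        then have "1 < e * cmod w" using e by (simp add: field_simps)
        then have "w \<noteq> 0" by auto
        then have "1 / cmod w < e" using \<open>1 < e * cmod w\<close> by (simp add: divide_less_eq)
        then have "1 / w \<in> U" using e(2) by (auto simp: norm_divide dist_norm)
        then show False using w \<open>w \<noteq> 0\<close> by (simp add: W_def)
      qed
      then show "w \<in> cball 0 (1 / e)" by simp
    qed
    then have "compact (- W)" using W by (metis bounded_subset bounded_cball closed_Compl compact_eq_bounded_closed)
    then show ?thesis unfolding openin_Alexandroff_compactification eq
      using W by (intro disjI2 exI[of _ "- W"]) auto
  qed
qed

lemma open_chart_preimage:
  assumes \<phi>: "\<phi> \<in> sphere_charts" and D: "openin sphere_top D"
  shows "open (\<phi> -` D)"
proof -
  have some: "open (Some -` D)"
  proof -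
    consider U where "open U" "D = Some ` U" | C where "closed C" "D = insert None (Some ` (UNIV - C))"
      using D unfolding openin_Alexandroff_compactification by auto
    then show ?thesis
    proof cases
      case 1
      then have "Some -` D = U" by auto
      then show ?thesis using 1 by simp
    next
      case 2
      then have "Some -` D = - C" by auto
      then show ?thesis using 2 by auto
    qed
  qed
  have rec: "open (recip -` D)"
  proof (cases "None \<in> D")
    case False
    then have "recip -` D = {w. w \<noteq> 0 \<and> 1 / w \<in> Some -` D}" by (auto simp: recip_def split: if_splits)
    then show ?thesis using open_reciprocal_preimage[OF some] by simp
  next
    case True
    then obtain C where C: "compact C" "D = insert None (Some ` (- C))"
      using D unfolding openin_Alexandroff_compactification by (auto simp: Compl_eq_Diff_UNIV)
    obtain M where M: "M > 0" "C \<subseteq> ball 0 M" using C(1) compact_imp_bounded bounded_subset_ballD by blast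
    have "recip -` D = {w. w \<noteq> 0 \<and> 1 / w \<in> Some -` D} \<union> ball 0 (1 / M)"
    proof -
      have "1 / w \<notin> C" if "cmod w < 1 / M" "w \<noteq> 0" for w
      proof
        assume "1 / w \<in> C"
        then have "1 / cmod w < M" using M(2) by (auto simp: norm_divide)
        then show False using that M(1) by (simp add: field_simps)
      qed
      then show ?thesis using C(2) M(1) by (auto simp: recip_def split: if_splits)
    qed
    then show ?thesis using open_reciprocal_preimage[OF some] by auto
  qed
  show ?thesis using \<phi> some rec by auto
qed

lemma sph_hol_compose:
  assumes h: "sph_hol h A" and g: "g holomorphic_on B" "open B" "g ` B \<subseteq> A"
  shows "sph_hol (\<lambda>z. h (g z)) B"
  unfolding sph_hol_def
proof
  fix z assume z: "z \<in> B"
  obtain r P Q where r: "r > 0" "P holomorphic_on ball (g z) r" "Q holomorphic_on ball (g z) r"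
    "\<And>w. w \<in> ball (g z) r \<Longrightarrow> P w \<noteq> 0 \<or> Q w \<noteq> 0" "\<And>w. w \<in> ball (g z) r \<Longrightarrow> h w = hpoint (P w) (Q w)"
    using sph_holE[OF h, of "g z"] z g(3) by blast
  have "open (B \<inter> g -` ball (g z) r)"
    using g by (intro continuous_open_preimage holomorphic_on_imp_continuous_on) auto
  moreover have "z \<in> B \<inter> g -` ball (g z) r" using z r by simp
  ultimately obtain s where s: "s > 0" "ball z s \<subseteq> B \<inter> g -` ball (g z) r"
    using open_contains_ball by blast
  have gs: "g holomorphic_on ball z s" using g(1) s(2) by (auto intro: holomorphic_on_subset)
  have "(P \<circ> g) holomorphic_on ball z s" "(Q \<circ> g) holomorphic_on ball z s"
    using s by (auto intro!: holomorphic_on_compose_gen[OF gs r(2)] holomorphic_on_compose_gen[OF gs r(3)])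
  moreover have "(P (g w) \<noteq> 0 \<or> Q (g w) \<noteq> 0) \<and> h (g w) = hpoint (P (g w)) (Q (g w))"
    if "w \<in> ball z s" for w
  proof -
    have "g w \<in> ball (g z) r" using that s by blast
    then show ?thesis using r(4,5) by blast
  qed
  ultimately show "\<exists>r>0. \<exists>P Q. P holomorphic_on ball z r \<and> Q holomorphic_on ball z r \<and>
     (\<forall>w\<in>ball z r. (P w \<noteq> 0 \<or> Q w \<noteq> 0) \<and> h (g w) = hpoint (P w) (Q w))"
    using s(1) by (intro exI[of _ s] conjI exI[of _ "P \<circ> g"] exI[of _ "Q \<circ> g"] ballI) auto
qed

lemma sph_hol_None_dichotomy:
  assumes h: "sph_hol h A" and z: "z \<in> A"
  shows "(\<forall>\<^sub>F w in nhds z. h w = None) \<or> (\<forall>\<^sub>F w in at z. h w \<noteq> None)"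
proof -
  have "sph_hol (\<lambda>z. recip 0) UNIV" by (rule sph_hol_recip) auto
  then have N: "sph_hol (\<lambda>z. None) A" using sph_hol_subset[of _ UNIV A] by (simp add: recip_def)
  obtain s where "s > 0" "(\<forall>w\<in>ball z s. h w = None) \<or> (\<forall>w\<in>ball z s - {z}. h w \<noteq> None)"
    using sph_hol_coincidence[OF h N z] by blast
  then show ?thesis
    by (auto simp: eventually_nhds_metric eventually_at dist_commute intro!: exI[of _ s])
qed

text \<open>
  As division by 0 gives 0, the function \<open>finite_part h\<close> equals \<open>P/Q\<close> also at the zeros of \<open>Q\<close>, and these
  are poles because \<open>Q\<close> does not vanish identically near any point.
\<close>

lemma sph_hol_imp_mero_map_on:
  assumes h: "sph_hol h A" and A: "open A" and nontriv: "\<And>z. z \<in> A \<Longrightarrow> \<not> (\<forall>\<^sub>F w in nhds z. h w = None)"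
  shows "mero_map_on h A"
proof -
  let ?f = "finite_part h"
  have loc: "?f meromorphic_on {z} \<and> (is_pole ?f z \<and> ?f z = 0 \<or> ?f \<midarrow>z\<rightarrow> ?f z) \<and> h z = to_sphere ?f z"
    if z: "z \<in> A" for z
  proof -
    obtain r P Q where r: "r > 0" "P holomorphic_on ball z r" "Q holomorphic_on ball z r"
      "\<And>w. w \<in> ball z r \<Longrightarrow> P w \<noteq> 0 \<or> Q w \<noteq> 0" "\<And>w. w \<in> ball z r \<Longrightarrow> h w = hpoint (P w) (Q w)"
      using sph_holE[OF h z] by blast
    have eq: "?f w = P w / Q w" if "w \<in> ball z r" for w
      using r(5)[OF that] by (simp add: finite_part_def hpoint_def)
    have evn: "\<forall>\<^sub>F w in nhds z. ?f w = P w / Q w"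
      using eq r(1) by (auto simp: eventually_nhds_metric dist_commute intro!: exI[of _ r])
    then have ev: "\<forall>\<^sub>F w in at z. ?f w = P w / Q w" by (simp add: eventually_nhds_conv_at)
    have an: "P analytic_on {z}" "Q analytic_on {z}" using r analytic_at by fastforce+
    have mer: "?f meromorphic_on {z}"
    proof (subst meromorphic_on_cong[where g = "\<lambda>w. P w / Q w" and B = "{z}"])
      show "(\<lambda>w. P w / Q w) meromorphic_on {z}"
        using an[THEN analytic_on_imp_meromorphic_on] by (rule meromorphic_on_divide)
    qed (use ev in auto)
    show ?thesis
    proof (cases "Q z = 0")
      case False
      have "(\<lambda>w. P w / Q w) analytic_on {z}" using an False by (intro analytic_intros) auto
      then have fa: "?f analytic_on {z}" using analytic_at_cong[OF evn refl] by simp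
      then have "?f \<midarrow>z\<rightarrow> ?f z" using analytic_at_imp_isCont isCont_def by blast
      moreover have "h z = to_sphere ?f z"
        using analytic_at_imp_no_pole[OF fa] r(1) r(5)[of z] eq[of z] False by (simp add: to_sphere_def hpoint_def)
      ultimately show ?thesis using mer by blast
    next
      case True
      have nz: "\<forall>\<^sub>F w in at z. h w \<noteq> None"
        using sph_hol_None_dichotomy[OF h z] nontriv[OF z] by blast
      have "\<forall>\<^sub>F w in at z. w \<in> ball z r"
        using r(1) by (intro eventually_at_in_open') auto
      then have "\<forall>\<^sub>F w in at z. Q w \<noteq> 0" using nz
        by eventually_elim (use r(5) in \<open>auto simp: hpoint_def split: if_splits\<close>)
      moreover have "Q \<midarrow>z\<rightarrow> 0" using analytic_at_imp_isCont[OF an(2)] True by (simp add: isCont_def)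
      ultimately have "filterlim Q (at 0) (at z)" by (simp add: filterlim_at)
      then have "is_pole (\<lambda>w. P w / Q w) z"
        using an(1) r(1,4) True by (intro is_pole_divide analytic_at_imp_isCont) auto
      then have "is_pole ?f z" using is_pole_cong[OF ev refl] by simp
      then show ?thesis using mer r(1) eq[of z] r(5)[of z] True by (simp add: to_sphere_def hpoint_def)
    qed
  qed
  then have "?f meromorphic_on A" by (meson meromorphic_on_meromorphic_at)
  then show ?thesis using loc by (auto simp: mero_map_on_def nicely_meromorphic_on_def)
qed

lemma mero_map_on_subset: "mero_map_on h A \<Longrightarrow> B \<subseteq> A \<Longrightarrow> mero_map_on h B"
  using nicely_meromorphic_on_subset unfolding mero_map_on_def by blast

text \<open>
  \<open>N\<close> is the set of points near which \<open>h\<close> is constantly infinite, \<open>E\<close> the interior of the rest. By the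
  identity theorem these open sets cover \<open>D\<close>, which is connected, so \<open>h\<close> is infinite throughout or
  nowhere locally.
\<close>

lemma sph_hol_imp_mero_inf:
  assumes D: "sphere_domain D" and h: "\<And>\<phi>. \<phi> \<in> sphere_charts \<Longrightarrow> sph_hol (h \<circ> \<phi>) (\<phi> -` D)"
  shows "h \<in> mero_inf D"
proof -
  have oD: "openin sphere_top D" and cD: "connectedin sphere_top D" using D by (auto simp: sphere_domain_def)
  define N where "N = \<Union>{V. openin sphere_top V \<and> V \<subseteq> D \<and> (\<forall>q\<in>V. h q = None)}"
  define E where "E = \<Union>{V. openin sphere_top V \<and> V \<subseteq> D \<and> V \<inter> N = {}}"
  have oN: "openin sphere_top N" and oE: "openin sphere_top E"
    unfolding N_def E_def by (auto intro!: openin_Union)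
  have inN: "\<phi> z \<in> N" if \<phi>: "\<phi> \<in> sphere_charts" and z: "\<phi> z \<in> D" and n: "\<forall>\<^sub>F w in nhds z. h (\<phi> w) = None" for \<phi> z
  proof -
    obtain S where S: "open S" "z \<in> S" "\<And>w. w \<in> S \<Longrightarrow> h (\<phi> w) = None"
      using n by (auto simp: eventually_nhds)
    have "open (S \<inter> \<phi> -` D)" using S open_chart_preimage[OF \<phi> oD] by auto
    then have "openin sphere_top (\<phi> ` (S \<inter> \<phi> -` D))" by (rule openin_chart_image[OF \<phi>])
    then show ?thesis unfolding N_def using S z
      by (intro UnionI[of "\<phi> ` (S \<inter> \<phi> -` D)"]) auto
  qed
  have inE: "\<phi> z \<in> E" if \<phi>: "\<phi> \<in> sphere_charts" and z: "\<phi> z \<in> D" and n: "\<not> (\<forall>\<^sub>F w in nhds z. h (\<phi> w) = None)"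
    for \<phi> z
  proof -
    have "\<forall>\<^sub>F w in at z. h (\<phi> w) \<noteq> None"
      using sph_hol_None_dichotomy[OF h[OF \<phi>], of z] z n by auto
    then obtain S where S: "open S" "z \<in> S" "\<And>w. w \<in> S \<Longrightarrow> w \<noteq> z \<Longrightarrow> h (\<phi> w) \<noteq> None"
      by (auto simp: eventually_at_topological)
    define V where "V = \<phi> ` (S \<inter> \<phi> -` D)"
    have V: "openin sphere_top V" unfolding V_def
      using S open_chart_preimage[OF \<phi> oD] by (intro openin_chart_image[OF \<phi>]) auto
    have "q \<notin> N" if q: "q \<in> V" for q
    proof
      assume "q \<in> N"
      then obtain X where X: "openin sphere_top X" "q \<in> X" "\<forall>p\<in>X. h p = None" unfolding N_def by blast
      obtain w where w: "w \<in> S" "q = \<phi> w" using q by (auto simp: V_def)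
      have "open (S \<inter> \<phi> -` X)" "w \<in> S \<inter> \<phi> -` X" using S open_chart_preimage[OF \<phi> X(1)] w X by auto
      then obtain e where e: "e > 0" "ball w e \<subseteq> S \<inter> \<phi> -` X" using open_contains_ball by blast
      have None: "\<forall>u\<in>ball w e. h (\<phi> u) = None" using e X(3) by auto
      show False
      proof (cases "w = z")
        case True
        then have "\<forall>\<^sub>F u in nhds z. h (\<phi> u) = None"
          using None e(1) by (auto simp: eventually_nhds_metric dist_commute intro!: exI[of _ e])
        then show False using n by blast
      next
        case False
        then show False using S(3)[OF w(1)] None e(1) by auto
      qed
    qed
    then have "V \<inter> N = {}" by blast
    then show ?thesis unfolding E_def using V z S(2) by (intro UnionI[of V]) (auto simp: V_def)
  qed
  have cover: "\<exists>\<phi>\<in>sphere_charts. \<exists>z. p = \<phi> z" for p :: csphere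
    by (cases p) (auto simp: recip_def)
  have "D \<subseteq> N \<union> E" using cover inN inE by (metis UnCI subsetI)
  moreover have "N \<inter> E \<inter> D = {}" by (auto simp: E_def)
  ultimately have "N \<inter> D = {} \<or> E \<inter> D = {}"
    using cD oN oE unfolding connectedin by blast
  then show ?thesis
  proof
    assume "E \<inter> D = {}"
    then have "D \<subseteq> N" using \<open>D \<subseteq> N \<union> E\<close> by blast
    then have "\<forall>p\<in>D. h p = None" by (auto simp: N_def)
    then show ?thesis by (simp add: mero_inf_def)
  next
    assume ND: "N \<inter> D = {}"
    have "mero_map_on (h \<circ> \<phi>) (\<phi> -` D)" if \<phi>: "\<phi> \<in> sphere_charts" for \<phi>
    proof (rule sph_hol_imp_mero_map_on[OF h[OF \<phi>] open_chart_preimage[OF \<phi> oD]])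
      show "\<not> (\<forall>\<^sub>F w in nhds z. (h \<circ> \<phi>) w = None)" if "z \<in> \<phi> -` D" for z
        using inN[OF \<phi>, of z] ND that by auto
    qed
    then show ?thesis by (simp add: mero_inf_def mero_def)
  qed
qed

text \<open>
  Go through the countably many properties, passing each time to a subsequence with the property in
  question whenever there is one. The diagonal sequence then has each property that any of its own
  subsequences has. This form suits compactness statements in which the neighbourhood of convergence
  depends on the sequence, so that no countable cover is given in advance.
\<close>

lemma diagonal_subsequence_countable:
  fixes Q :: "'i \<Rightarrow> (nat \<Rightarrow> nat) \<Rightarrow> bool"
  assumes I: "countable I"
    and sub: "\<And>i r r'. Q i r \<Longrightarrow> strict_mono r' \<Longrightarrow> Q i (r \<circ> r')"
    and tail: "\<And>i r m. Q i (r \<circ> (+) m) \<Longrightarrow> Q i r"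
  shows "\<exists>d. strict_mono (d :: nat \<Rightarrow> nat) \<and>
    (\<forall>i\<in>I. \<forall>r. strict_mono r \<longrightarrow> Q i (d \<circ> r) \<longrightarrow> Q i d)"
proof (cases "I = {}")
  case True
  then show ?thesis by (intro exI[of _ id]) (auto simp: strict_mono_def)
next
  case False
  define P where "P n s \<longleftrightarrow> Q (from_nat_into I n) s \<or> (\<forall>r. strict_mono r \<longrightarrow> \<not> Q (from_nat_into I n) (s \<circ> r))"
    for n s
  interpret subseqs P
  proof
    fix n and s :: "nat \<Rightarrow> nat" assume "strict_mono s"
    show "\<exists>r'. strict_mono r' \<and> P n (s \<circ> r')"
    proof (cases "\<exists>r. strict_mono r \<and> Q (from_nat_into I n) (s \<circ> r)")
      case True
      then show ?thesis by (auto simp: P_def)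
    next
      case False
      then show ?thesis by (intro exI[of _ id]) (auto simp: P_def strict_mono_def)
    qed
  qed
  have stable: "P n (s \<circ> r)" if "strict_mono r" "P n s" for r s n
    using that sub unfolding P_def by (metis comp_assoc strict_mono_o)
  show ?thesis
  proof (intro exI[of _ diagseq] conjI ballI allI impI)
    show "strict_mono diagseq" by (rule subseq_diagseq)
    fix i r assume i: "i \<in> I" and r: "strict_mono r" and Qr: "Q i (diagseq \<circ> r)"
    obtain k where k: "i = from_nat_into I k" using from_nat_into_surj[OF I i] by metis
    have "P k (diagseq \<circ> (+) (Suc k))" using diagseq_holds stable by blast
    then consider "Q i (diagseq \<circ> (+) (Suc k))" | "\<And>r. strict_mono r \<Longrightarrow> \<not> Q i (diagseq \<circ> (+) (Suc k) \<circ> r)"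
      unfolding P_def k by blast
    then show "Q i diagseq"
    proof cases
      case 1
      then show ?thesis by (rule tail)
    next
      case 2
      \<comment> \<open>a reindexing that makes the tail of \<open>diagseq \<circ> r\<close> a subsequence of the tail of \<open>diagseq\<close>\<close>
      define r' where "r' n = r (Suc k + n) - Suc k" for n
      have ge: "Suc k + n \<le> r (Suc k + n)" for n using r by (rule strict_mono_imp_increasing)
      have "strict_mono r'" unfolding strict_mono_Suc_iff
      proof
        fix n
        show "r' n < r' (Suc n)"
          using ge[of n] strict_monoD[OF r, of "Suc k + n" "Suc k + Suc n"] by (simp add: r'_def)
      qed
      moreover have "diagseq \<circ> (+) (Suc k) \<circ> r' = diagseq \<circ> r \<circ> (+) (Suc k)"
      proof
        fix n
        show "(diagseq \<circ> (+) (Suc k) \<circ> r') n = (diagseq \<circ> r \<circ> (+) (Suc k)) n"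
          using ge[of n] by (simp add: r'_def)
      qed
      moreover have "Q i (diagseq \<circ> r \<circ> (+) (Suc k))"
        using Qr by (rule sub) (simp add: strict_mono_def)
      ultimately show ?thesis using 2[of r'] by simp
    qed
  qed
qed

lemma sph_uconv_subset: "sph_uconv s h A \<Longrightarrow> B \<subseteq> A \<Longrightarrow> sph_uconv s h B"
  unfolding sph_uconv_def by (blast intro: eventually_mono)

lemma mero_inf_imp_sph_hol:
  assumes "f \<in> mero_inf D" "\<phi> \<in> sphere_charts" "openin sphere_top D"
  shows "sph_hol (f \<circ> \<phi>) (\<phi> -` D)"
proof (cases "f \<in> mero D")
  case True
  then have "mero_map_on (f \<circ> \<phi>) (\<phi> -` D)" using assms(2) unfolding mero_def by blast
  then show ?thesis by (rule mero_map_on_imp_sph_hol) (rule open_chart_preimage[OF assms(2,3)])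
next
  case False
  then have None: "\<forall>p\<in>D. f p = None" using assms(1) by (auto simp: mero_inf_def)
  have op: "open (\<phi> -` D)" by (rule open_chart_preimage[OF assms(2,3)])
  have "sph_hol (\<lambda>z. recip 0) (\<phi> -` D)" using op by (intro sph_hol_recip) auto
  then show ?thesis by (rule sph_hol_cong) (use None op in \<open>auto simp: recip_def\<close>)
qed

theorem theorem1p4:
  fixes D :: "csphere set" and k :: nat and \<F> :: "(csphere \<Rightarrow> csphere) set"
    and \<epsilon> :: real and a :: "nat \<Rightarrow> (csphere \<Rightarrow> csphere) \<Rightarrow> csphere \<Rightarrow> csphere"
  assumes "sphere_domain D"
    and "k \<ge> 1"
    and "\<F> \<subseteq> mero D"
    and "\<forall>f\<in>\<F>. zeros_mult_ge (k + 1) f D"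
    and "\<epsilon> > 0"
    and "\<forall>f\<in>\<F>. \<forall>j\<in>{1,2,3}. a j f \<in> mero_inf D"
    and "\<forall>f\<in>\<F>. \<forall>j\<in>{1,2,3}. \<forall>l\<in>{1,2,3}. j \<noteq> l \<longrightarrow>
           (\<forall>p\<in>D. sph_dist (a j f p) (a l f p) \<ge> \<epsilon>)"
    and share: "\<forall>f\<in>\<F>. \<forall>g\<in>\<F>. \<forall>j\<in>{1,2,3}. \<forall>z\<in>Some -` D.
           mderiv k (f \<circ> Some) z = a j f (Some z) \<longleftrightarrow> mderiv k (g \<circ> Some) z = a j g (Some z)"
    \<comment> \<open>near infinity, if that point belongs to \<open>D\<close>, derivatives are taken in the coordinate \<open>1/z\<close>\<close>
    and share_inf: "None \<in> D \<Longrightarrow> \<forall>\<^sub>F w in nhds 0. \<forall>f\<in>\<F>. \<forall>g\<in>\<F>. \<forall>j\<in>{1,2,3}.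
           mderiv k (f \<circ> recip) w = a j f (recip w) \<longleftrightarrow> mderiv k (g \<circ> recip) w = a j g (recip w)"
  shows "normal_family D \<F>"
proof -
  have oD: "openin sphere_top D" using assms(1) by (simp add: sphere_domain_def)
  define S where "S \<phi> z \<longleftrightarrow> (\<forall>f\<in>\<F>. \<forall>g\<in>\<F>. \<forall>j\<in>{1,2,3}.
      mderiv k (f \<circ> \<phi>) z = a j f (\<phi> z) \<longleftrightarrow> mderiv k (g \<circ> \<phi>) z = a j g (\<phi> z))"
    for \<phi> :: "complex \<Rightarrow> csphere" and z
  have S_Some: "S Some z" if "z \<in> Some -` D" for z using share that unfolding S_def by blast
  have S_recip: "\<forall>\<^sub>F w in nhds 0. S recip w" if "None \<in> D" unfolding S_def by (rule share_inf[OF that])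
  \<comment> \<open>points other than \<open>None\<close> are treated in the chart \<open>Some\<close>, where \<open>share\<close> is available, and only
    \<open>None\<close> is treated in the chart \<open>recip\<close>\<close>
  have local: "\<exists>r h \<rho>. strict_mono (r :: nat \<Rightarrow> nat) \<and> \<rho> > 0 \<and> ball z0 \<rho> \<subseteq> \<phi> -` D \<and> sph_hol h (ball z0 \<rho>) \<and>
      sph_uconv (\<lambda>n z. s (r n) (\<phi> z)) h (ball z0 \<rho>)"
    if s: "range s \<subseteq> \<F>" and \<phi>: "\<phi> \<in> sphere_charts" and z0: "z0 \<in> \<phi> -` D" "\<phi> = Some \<or> z0 = 0" for s \<phi> z0
  proof -
    obtain R0 where R0: "R0 > 0" "ball z0 R0 \<subseteq> \<phi> -` D"
      using open_chart_preimage[OF \<phi> oD] z0(1) open_contains_ball by blast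
    obtain R1 where R1: "R1 > 0" and sh: "\<And>z. z \<in> ball z0 R1 \<Longrightarrow> z \<in> \<phi> -` D \<Longrightarrow> S \<phi> z"
    proof (cases "\<phi> = Some")
      case True
      then show thesis using S_Some by (intro that[of 1]) auto
    next
      case False
      then have rec: "\<phi> = recip" "z0 = 0" using \<phi> z0 by auto
      then have "None \<in> D" using z0(1) by (simp add: recip_def)
      then obtain e where "e > 0" "\<And>w. dist w 0 < e \<Longrightarrow> S recip w"
        using S_recip unfolding eventually_nhds_metric by blast
      then show thesis using rec by (intro that[of e]) auto
    qed
    define R where "R = min R0 R1"
    have R: "R > 0" "ball z0 R \<subseteq> \<phi> -` D" "ball z0 R \<subseteq> ball z0 R1" using R0 R1 by (auto simp: R_def)
    have sF: "s n \<in> \<F>" for n using s by auto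
    obtain r h \<rho> where "strict_mono (r :: nat \<Rightarrow> nat)" "\<rho> > 0" "\<rho> \<le> R" "sph_hol h (ball z0 \<rho>)"
      "sph_uconv (\<lambda>n. (s (r n) \<circ> \<phi>)) h (ball z0 \<rho>)"
    proof (rule planar_normality[where f = "\<lambda>n. s n \<circ> \<phi>" and a = "\<lambda>j n. a j (s n) \<circ> \<phi>"])
      show "R > 0" "\<epsilon> > 0" "k \<ge> 1" by fact+
      show "mero_map_on (s n \<circ> \<phi>) (ball z0 R)" for n
        using sF[of n] assms(3) \<phi> R(2) mero_map_on_subset unfolding mero_def by blast
      show "zero_mult_ge (k + 1) (finite_part (s n \<circ> \<phi>)) z" if "z \<in> ball z0 R" "(s n \<circ> \<phi>) z = Some 0" for n z
      proof -
        have "z \<in> \<phi> -` D" using that R(2) by blast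
        moreover have "zeros_mult_ge (k + 1) (s n) D" using assms(4) sF by blast
        ultimately show ?thesis using that(2) \<phi> unfolding zeros_mult_ge_def o_apply by blast
      qed
      show "sph_hol (a j (s n) \<circ> \<phi>) (ball z0 R)" if "j \<in> {1,2,3}" for n j
        using assms(6) sF that by (intro sph_hol_subset[OF mero_inf_imp_sph_hol[OF _ \<phi> oD] R(2)]) blast
      show "\<epsilon> \<le> sph_dist ((a j (s n) \<circ> \<phi>) z) ((a l (s n) \<circ> \<phi>) z)"
        if "j \<in> {1,2,3}" "l \<in> {1,2,3}" "j \<noteq> l" "z \<in> ball z0 R" for n j l z
      proof -
        have "\<phi> z \<in> D" using that(4) R(2) by blast
        then show ?thesis using assms(7) sF that(1-3) unfolding o_apply by blast
      qed
      show "mderiv k (s n \<circ> \<phi>) z = (a j (s n) \<circ> \<phi>) z \<longleftrightarrow> mderiv k (s m \<circ> \<phi>) z = (a j (s m) \<circ> \<phi>) z"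
        if "j \<in> {1,2,3}" "z \<in> ball z0 R" for n m j z
      proof -
        have "S \<phi> z" using that(2) R(2,3) by (intro sh) blast+
        then show ?thesis using that(1) sF[of n] sF[of m] unfolding S_def o_apply[of "a j _"] by blast
      qed
    qed (auto simp: o_def)
    moreover have "ball z0 \<rho> \<subseteq> \<phi> -` D" using R(2) \<open>\<rho> \<le> R\<close> by (meson order_trans subset_ball)
    ultimately show ?thesis unfolding o_def by blast
  qed
  show ?thesis unfolding normal_family_def
  proof (intro allI impI)
    fix s :: "nat \<Rightarrow> csphere \<Rightarrow> csphere" assume s: "range s \<subseteq> \<F>"
    obtain \<G> :: "complex set set" where \<G>: "countable \<G>" "topological_basis \<G>"
      using ex_countable_basis by blast
    \<comment> \<open>the subsequence \<open>r\<close> converges on the base set \<open>snd i\<close> of the chart \<open>fst i\<close>\<close>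
    define Q where "Q i r \<longleftrightarrow> (\<exists>h. sph_hol h (snd i) \<and> sph_uconv (\<lambda>n z. s (r n) (fst i z)) h (snd i))"
      for i :: "(complex \<Rightarrow> csphere) \<times> complex set" and r :: "nat \<Rightarrow> nat"
    have cnt: "countable (sphere_charts \<times> \<G>)" using \<G> by (intro countable_SIGMA) auto
    have Q_sub: "Q i (r \<circ> r')" if Q: "Q i r" and r': "strict_mono r'" for i r r'
    proof -
      obtain h where h: "sph_hol h (snd i)" "sph_uconv (\<lambda>n z. s (r n) (fst i z)) h (snd i)"
        using Q unfolding Q_def by blast
      have "sph_uconv (\<lambda>n z. s ((r \<circ> r') n) (fst i z)) h (snd i)"
        unfolding sph_uconv_def
      proof (intro allI impI)
        fix e :: real assume "e > 0"
        then have "\<forall>\<^sub>F n in sequentially. \<forall>q\<in>snd i. sph_dist (s (r n) (fst i q)) (h q) < e"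
          using h(2) unfolding sph_uconv_def by blast
        from eventually_subseq[OF r' this]
        show "\<forall>\<^sub>F n in sequentially. \<forall>q\<in>snd i. sph_dist (s ((r \<circ> r') n) (fst i q)) (h q) < e" by simp
      qed
      then show ?thesis using h(1) unfolding Q_def by blast
    qed
    have Q_tail: "Q i r" if Q: "Q i (r \<circ> (+) m)" for i r m
    proof -
      obtain h where h: "sph_hol h (snd i)" "sph_uconv (\<lambda>n z. s ((r \<circ> (+) m) n) (fst i z)) h (snd i)"
        using Q unfolding Q_def by blast
      have "sph_uconv (\<lambda>n z. s (r n) (fst i z)) h (snd i)"
        unfolding sph_uconv_def
      proof (intro allI impI)
        fix e :: real assume "e > 0"
        then have "\<forall>\<^sub>F n in sequentially. \<forall>q\<in>snd i. sph_dist (s (r (n + m)) (fst i q)) (h q) < e"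
          using h(2) unfolding sph_uconv_def by (simp add: add.commute)
        then show "\<forall>\<^sub>F n in sequentially. \<forall>q\<in>snd i. sph_dist (s (r n) (fst i q)) (h q) < e"
          by (subst (asm) eventually_sequentially_seg)
      qed
      then show ?thesis using h(1) unfolding Q_def by blast
    qed
    have "\<exists>d. strict_mono (d :: nat \<Rightarrow> nat) \<and>
        (\<forall>i\<in>sphere_charts \<times> \<G>. \<forall>r. strict_mono r \<longrightarrow> Q i (d \<circ> r) \<longrightarrow> Q i d)"
      by (rule diagonal_subsequence_countable[OF cnt]) (fact Q_sub Q_tail)+
    then obtain d where d: "strict_mono (d :: nat \<Rightarrow> nat)"
      "\<And>i r. \<lbrakk>i \<in> sphere_charts \<times> \<G>; strict_mono r; Q i (d \<circ> r)\<rbrakk> \<Longrightarrow> Q i d" by blast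
    have conv: "\<exists>U h. open U \<and> z0 \<in> U \<and> U \<subseteq> \<phi> -` D \<and> sph_hol h U \<and> sph_uconv (\<lambda>n z. s (d n) (\<phi> z)) h U"
      if \<phi>: "\<phi> \<in> sphere_charts" and z0: "z0 \<in> \<phi> -` D" "\<phi> = Some \<or> z0 = 0" for \<phi> z0
    proof -
      have "range (s \<circ> d) \<subseteq> \<F>" using s by auto
      from local[OF this \<phi> z0] obtain r h \<rho> where r: "strict_mono r" "\<rho> > 0" "ball z0 \<rho> \<subseteq> \<phi> -` D"
        "sph_hol h (ball z0 \<rho>)" "sph_uconv (\<lambda>n z. (s \<circ> d) (r n) (\<phi> z)) h (ball z0 \<rho>)" by blast
      obtain U where U: "U \<in> \<G>" "z0 \<in> U" "U \<subseteq> ball z0 \<rho>"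
        using topological_basisE[OF \<G>(2) open_ball, of z0 z0 \<rho>] r(2) by auto
      have "sph_hol h U" using r(4) U(3) by (rule sph_hol_subset)
      moreover have "sph_uconv (\<lambda>n z. s ((d \<circ> r) n) (\<phi> z)) h U"
        using sph_uconv_subset[OF r(5) U(3)] by (simp add: o_def)
      ultimately have "Q (\<phi>, U) (d \<circ> r)" unfolding Q_def fst_conv snd_conv by blast
      then have "Q (\<phi>, U) d" using d(2) r(1) \<phi> U(1) by blast
      moreover have "open U" using U(1) \<G>(2) topological_basis_open by blast
      moreover have "U \<subseteq> \<phi> -` D" using U(3) r(3) by blast
      ultimately show ?thesis using U(2) unfolding Q_def fst_conv snd_conv by blast
    qed
    \<comment> \<open>the local limits agree on overlaps because they are pointwise limits\<close>
    define h where "h p = (SOME q. (\<lambda>n. sph_dist (s (d n) p) q) \<longlonglongrightarrow> 0)" for p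
    have h_eq: "h (\<phi> z) = g z"
      if g: "sph_uconv (\<lambda>n z. s (d n) (\<phi> z)) g U" and z: "z \<in> U" for \<phi> g U z
    proof -
      have "(\<lambda>n. sph_dist (s (d n) (\<phi> z)) (g z)) \<longlonglongrightarrow> 0"
      proof (rule tendstoI)
        fix e :: real assume "e > 0"
        with g have "\<forall>\<^sub>F n in sequentially. \<forall>q\<in>U. sph_dist (s (d n) (\<phi> q)) (g q) < e"
          unfolding sph_uconv_def by blast
        then show "\<forall>\<^sub>F n in sequentially. dist (sph_dist (s (d n) (\<phi> z)) (g z)) 0 < e"
        proof eventually_elim
          case (elim n)
          have "0 \<le> sph_dist (s (d n) (\<phi> z)) (g z)"
            unfolding sph_dist_def using stereo_inner_le_1 stereo_inner_ge_m1 by (intro arccos_lbound)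
          then show ?case using elim z by simp
        qed
      qed
      then show ?thesis unfolding h_def using sph_dist_limit_unique by (intro some_equality) blast+
    qed
    have near: "\<exists>U. open U \<and> z0 \<in> U \<and> U \<subseteq> \<phi> -` D \<and> sph_hol (h \<circ> \<phi>) U \<and>
        sph_uconv (\<lambda>n z. s (d n) (\<phi> z)) (h \<circ> \<phi>) U"
      if \<phi>: "\<phi> \<in> sphere_charts" and z0: "z0 \<in> \<phi> -` D" "\<phi> = Some \<or> z0 = 0" for \<phi> z0
    proof -
      obtain U g where U: "open U" "z0 \<in> U" "U \<subseteq> \<phi> -` D" "sph_hol g U"
        and g: "sph_uconv (\<lambda>n z. s (d n) (\<phi> z)) g U" using conv[OF \<phi> z0] by blast
      have eq: "g z = (h \<circ> \<phi>) z" if "z \<in> U" for z using h_eq[OF g that] by simp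
      have "sph_hol (h \<circ> \<phi>) U" using U(4,1) eq by (rule sph_hol_cong)
      moreover have "sph_uconv (\<lambda>n z. s (d n) (\<phi> z)) (h \<circ> \<phi>) U"
        using g eq unfolding sph_uconv_def by simp
      ultimately show ?thesis using U by blast
    qed
    have hol_Some: "sph_hol (h \<circ> Some) (Some -` D)"
      unfolding sph_hol_def
    proof
      fix z assume "z \<in> Some -` D"
      then obtain U where "z \<in> U" "sph_hol (h \<circ> Some) U" using near[of Some z] by auto
      then show "\<exists>r>0. \<exists>P Q. P holomorphic_on ball z r \<and> Q holomorphic_on ball z r \<and>
          (\<forall>w\<in>ball z r. (P w \<noteq> 0 \<or> Q w \<noteq> 0) \<and> (h \<circ> Some) w = hpoint (P w) (Q w))"
        unfolding sph_hol_def by blast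
    qed
    \<comment> \<open>\<open>near\<close> covers only the origin of this chart; elsewhere it is the other chart composed with \<open>1/z\<close>\<close>
    have hol_recip: "sph_hol (h \<circ> recip) (recip -` D)"
    proof -
      define A where "A = recip -` D - {0}"
      have A: "open A" unfolding A_def using open_chart_preimage[OF _ oD, of recip] by (intro open_Diff) auto
      have "sph_hol (\<lambda>z. (h \<circ> Some) (1 / z)) A"
        by (rule sph_hol_compose[OF hol_Some _ A])
           (auto simp: A_def recip_def intro!: holomorphic_intros)
      then have 1: "sph_hol (h \<circ> recip) A"
        by (rule sph_hol_cong[OF _ A]) (auto simp: A_def recip_def)
      have 2: "sph_hol (h \<circ> recip) {0}" if "0 \<in> recip -` D"
      proof -
        obtain U where U: "0 \<in> U" "sph_hol (h \<circ> recip) U" using near[of recip 0] \<open>0 \<in> recip -` D\<close> by auto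
        show ?thesis using sph_hol_subset[OF U(2)] U(1) by simp
      qed
      show ?thesis unfolding sph_hol_def
      proof
        fix z assume z: "z \<in> recip -` D"
        show "\<exists>r>0. \<exists>P Q. P holomorphic_on ball z r \<and> Q holomorphic_on ball z r \<and>
          (\<forall>w\<in>ball z r. (P w \<noteq> 0 \<or> Q w \<noteq> 0) \<and> (h \<circ> recip) w = hpoint (P w) (Q w))"
        proof (cases "z = 0")
          case True
          then show ?thesis using 2 z unfolding sph_hol_def by simp
        next
          case False
          then have "z \<in> A" using z by (simp add: A_def)
          then show ?thesis using 1 unfolding sph_hol_def by blast
        qed
      qed
    qed
    have "h \<in> mero_inf D"
      by (rule sph_hol_imp_mero_inf[OF assms(1)]) (use hol_Some hol_recip in auto)
    moreover have "\<exists>V. openin sphere_top V \<and> p \<in> V \<and> V \<subseteq> D \<and>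
        (\<forall>e>0. \<forall>\<^sub>F n in sequentially. \<forall>q\<in>V. sph_dist (s (d n) q) (h q) < e)" if p: "p \<in> D" for p
    proof -
      obtain \<phi> z0 where \<phi>: "\<phi> \<in> sphere_charts" and z0: "\<phi> z0 = p" "\<phi> = Some \<or> z0 = 0"
      proof (cases p)
        case None
        then show ?thesis by (intro that[of recip 0]) (auto simp: recip_def)
      next
        case (Some z)
        then show ?thesis by (intro that[of Some z]) auto
      qed
      have "z0 \<in> \<phi> -` D" using z0 p by simp
      from near[OF \<phi> this z0(2)] obtain U where U: "open U" "z0 \<in> U" "U \<subseteq> \<phi> -` D"
        "sph_uconv (\<lambda>n z. s (d n) (\<phi> z)) (h \<circ> \<phi>) U" by blast
      show ?thesis
      proof (intro exI[of _ "\<phi> ` U"] conjI)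
        show "openin sphere_top (\<phi> ` U)" by (rule openin_chart_image[OF \<phi> U(1)])
        show "p \<in> \<phi> ` U" using U(2) z0(1) by blast
        show "\<phi> ` U \<subseteq> D" using U(3) by blast
        show "\<forall>e>0. \<forall>\<^sub>F n in sequentially. \<forall>q\<in>\<phi> ` U. sph_dist (s (d n) q) (h q) < e"
          using U(4) by (simp add: sph_uconv_def)
      qed
    qed
    ultimately show "\<exists>r h. strict_mono (r :: nat \<Rightarrow> nat) \<and> h \<in> mero_inf D \<and>
         (\<forall>p\<in>D. \<exists>U. openin sphere_top U \<and> p \<in> U \<and> U \<subseteq> D \<and>
           (\<forall>e>0. \<forall>\<^sub>F n in sequentially. \<forall>q\<in>U. sph_dist (s (r n) q) (h q) < e))"
      using d(1) by blast
  qed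
qed

end
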